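(* Let $d\ge1$ and let $\mathcal{T}_1,\dots,\mathcal{T}_d$ be weakly mixing flows, $\mathcal{T}_i$ acting on $(X_i,\mathcal{B}_i,\mu_i)$, such that for some sequence of reals $t_n\to\infty$ and some $\alpha_1,\dots,\alpha_d\in(0,1)$ each $\mathcal{T}_i$ is $\alpha_i$-weakly mixing along $(t_n)$. Then every element of the centralizer $C(\mathcal{T}_1\times\dots\times\mathcal{T}_d)$ is, up to a permutation of coordinates between isomorphic factors, a product of elements of the centralizers of the $\mathcal{T}_i$. That is, for every $R\in C(\mathcal{T}_1\times\dots\times\mathcal{T}_d)$ there are a permutation $\sigma$ of $\{1,\dots,d\}$ such that $\mathcal{T}_i$ is isomorphic to $\mathcal{T}_{\sigma(i)}$ for every $i$, and isomorphisms $Q_i\colon X_{\sigma(i)}\to X_i$ between $\mathcal{T}_{\sigma(i)}$ and $\mathcal{T}_i$ (i.e. $T_i^t\circ Q_i=Q_i\circ T_{\sigma(i)}^t$ for all $t$), such that $$R(x_1,\dots,x_d)=(Q_1x_{\sigma(1)},\dots,Q_dx_{\sigma(d)})\quad\text{for a.e. }(x_1,\dots,x_d).$$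
   Context: A flow $\mathcal{T}=(T^t)_{t\in\mathbb{R}}$ is a measure-preserving $\mathbb{R}$-action on a standard Borel probability space $(X,\mathcal{B},\mu)$ such that $t\mapsto\langle f\circ T^t,g\rangle$ is continuous for all $f,g\in L^2(X,\mathcal{B},\mu)$. All flows are assumed nontrivial (the space is not a one-point space up to measure zero). The product flow is $(T_1^t\times\dots\times T_d^t)_{t\in\mathbb{R}}$ on the product probability space. A flow $\mathcal{T}$ is weakly mixing if $\mathcal{T}\times\mathcal{T}$ is ergodic. An isomorphism between flows $\mathcal{S}$ on $Y$ and $\mathcal{T}$ on $X$ is an invertible (mod null sets) measure-preserving map $\Phi\colon Y\to X$ with $T^t\circ\Phi=\Phi\circ S^t$ a.e. for every $t$. The centralizer $C(\mathcal{T})$ is the group of invertible measure-preserving maps of $(X,\mathcal{B},\mu)$ (mod null sets) commuting with all $T^t$. Write $T^tf=f\circ T^t$ and $\Pi f=\int f\,d\mu$ for $f\in L^2(X,\mathcal{B},\mu)$. For $\alpha\in(0,1)$, $\mathcal{T}$ is $\alpha$-weakly mixing along $t_n\to\infty$ if $T^{t_n}\to\alpha\cdot\Pi+(1-\alpha)\cdot\mathrm{Id}$ in the weak operator topology on $L^2(X,\mathcal{B},\mu)$. *)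

theory Defs
  imports "HOL-Probability.Probability"
begin

definition standard_borel :: "'a measure \<Rightarrow> bool" where
  "standard_borel M \<longleftrightarrow>
     (\<exists>X. completely_metrizable_space X \<and> second_countable X \<and> topspace X = space M \<and>
          sets M = sigma_sets (space M) {U. openin X U})"

definition measure_preserving_map :: "'a measure \<Rightarrow> 'b measure \<Rightarrow> ('a \<Rightarrow> 'b) \<Rightarrow> bool" where
  "measure_preserving_map N M \<Phi> \<longleftrightarrow> \<Phi> \<in> measurable N M \<and> distr N M \<Phi> = M"

definition invertible_mp_map :: "'a measure \<Rightarrow> 'b measure \<Rightarrow> ('a \<Rightarrow> 'b) \<Rightarrow> bool" where
  "invertible_mp_map N M \<Phi> \<longleftrightarrow>
     measure_preserving_map N M \<Phi> \<and>
     (\<exists>\<Psi>. measure_preserving_map M N \<Psi> \<and>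
          (AE y in N. \<Psi> (\<Phi> y) = y) \<and> (AE x in M. \<Phi> (\<Psi> x) = x))"

definition L2 :: "'a measure \<Rightarrow> ('a \<Rightarrow> complex) set" where
  "L2 M = {f \<in> borel_measurable M. integrable M (\<lambda>x. (norm (f x))\<^sup>2)}"

definition L2_inner :: "'a measure \<Rightarrow> ('a \<Rightarrow> complex) \<Rightarrow> ('a \<Rightarrow> complex) \<Rightarrow> complex" where
  "L2_inner M f g = (\<integral>x. f x * cnj (g x) \<partial>M)"

definition weak_operator_tendsto ::
    "'a measure \<Rightarrow> (nat \<Rightarrow> ('a \<Rightarrow> complex) \<Rightarrow> 'a \<Rightarrow> complex) \<Rightarrow>
     (('a \<Rightarrow> complex) \<Rightarrow> 'a \<Rightarrow> complex) \<Rightarrow> bool" where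
  "weak_operator_tendsto M A B \<longleftrightarrow>
     (\<forall>f\<in>L2 M. \<forall>g\<in>L2 M. (\<lambda>n. L2_inner M (A n f) g) \<longlonglongrightarrow> L2_inner M (B f) g)"

(* The action identities are only required almost everywhere, for each fixed pair of times;
   a pointwise action is a special case. The last conjunct but one excludes
   one-point spaces up to measure zero. *)
definition flow :: "'a measure \<Rightarrow> (real \<Rightarrow> 'a \<Rightarrow> 'a) \<Rightarrow> bool" where
  "flow M T \<longleftrightarrow>
     prob_space M \<and> standard_borel M \<and>
     (\<forall>t. measure_preserving_map M M (T t)) \<and>
     (AE x in M. T 0 x = x) \<and>
     (\<forall>s t. AE x in M. T (s + t) x = T s (T t x)) \<and>
     \<not> (\<exists>x\<^sub>0\<in>space M. AE x in M. x = x\<^sub>0) \<and>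
     (\<forall>f\<in>L2 M. \<forall>g\<in>L2 M. continuous_on UNIV (\<lambda>t. L2_inner M (f \<circ> T t) g))"

(* Sets are invariant modulo null sets, as everything else here. *)
definition ergodic :: "'a measure \<Rightarrow> (real \<Rightarrow> 'a \<Rightarrow> 'a) \<Rightarrow> bool" where
  "ergodic M T \<longleftrightarrow>
     (\<forall>A\<in>sets M. (\<forall>t. AE x in M. T t x \<in> A \<longleftrightarrow> x \<in> A) \<longrightarrow>
        measure M A = 0 \<or> measure M A = 1)"

definition weakly_mixing :: "'a measure \<Rightarrow> (real \<Rightarrow> 'a \<Rightarrow> 'a) \<Rightarrow> bool" where
  "weakly_mixing M T \<longleftrightarrow> ergodic (M \<Otimes>\<^sub>M M) (\<lambda>t. map_prod (T t) (T t))"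

definition alpha_weakly_mixing_along ::
    "real \<Rightarrow> (nat \<Rightarrow> real) \<Rightarrow> 'a measure \<Rightarrow> (real \<Rightarrow> 'a \<Rightarrow> 'a) \<Rightarrow> bool" where
  "alpha_weakly_mixing_along \<alpha> \<tau> M T \<longleftrightarrow>
     weak_operator_tendsto M (\<lambda>n f. f \<circ> T (\<tau> n))
       (\<lambda>f x. of_real \<alpha> * (\<integral>y. f y \<partial>M) + of_real (1 - \<alpha>) * f x)"

definition product_flow :: "'i set \<Rightarrow> ('i \<Rightarrow> real \<Rightarrow> 'a \<Rightarrow> 'a) \<Rightarrow> real \<Rightarrow> ('i \<Rightarrow> 'a) \<Rightarrow> 'i \<Rightarrow> 'a" where
  "product_flow I T t x = (\<lambda>i\<in>I. T i t (x i))"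

definition flow_isomorphism ::
    "'a measure \<Rightarrow> (real \<Rightarrow> 'a \<Rightarrow> 'a) \<Rightarrow> 'b measure \<Rightarrow> (real \<Rightarrow> 'b \<Rightarrow> 'b) \<Rightarrow> ('a \<Rightarrow> 'b) \<Rightarrow> bool" where
  "flow_isomorphism N S M T \<Phi> \<longleftrightarrow>
     invertible_mp_map N M \<Phi> \<and> (\<forall>t. AE y in N. T t (\<Phi> y) = \<Phi> (S t y))"

definition isomorphic_flows ::
    "'a measure \<Rightarrow> (real \<Rightarrow> 'a \<Rightarrow> 'a) \<Rightarrow> 'b measure \<Rightarrow> (real \<Rightarrow> 'b \<Rightarrow> 'b) \<Rightarrow> bool" where
  "isomorphic_flows N S M T \<longleftrightarrow> (\<exists>\<Phi>. flow_isomorphism N S M T \<Phi>)"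

(* The centralizer is represented by actual maps, i.e. by all representatives of its classes
   modulo null sets. *)
definition centralizer :: "'a measure \<Rightarrow> (real \<Rightarrow> 'a \<Rightarrow> 'a) \<Rightarrow> ('a \<Rightarrow> 'a) set" where
  "centralizer M T =
     {R. invertible_mp_map M M R \<and> (\<forall>t. AE x in M. R (T t x) = T t (R x))}"

end

theory Submission
  imports Defs
begin

text \<open>Let \<open>P\<close> be the product measure and \<open>\<beta> i = 1 - \<alpha> i\<close>. Along \<open>\<tau>\<close> the Koopman operators of the product flow
converge weakly to the tensor product of the operators \<open>(1 - \<beta> i) \<Pi> + \<beta> i Id\<close>. This limit is a noise
operator: independently for each \<open>i\<close> it keeps the coordinate \<open>x i\<close> with probability \<open>\<beta> i\<close> and otherwise
replaces it by a fresh sample. If \<open>R\<close> commutes with the flow, then it commutes with the noise operator, so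
the set \<open>E = {x. R x i \<in> A}\<close> satisfies the eigenvalue equation
\<open>noise E = (1 - \<beta> i) \<mu>(A) + \<beta> i 1\<^sub>E\<close> almost everywhere (\<open>noise_pullback\<close>). The proof shows that \<open>E\<close>
depends on a single coordinate.

The analytic step is a dichotomy (\<open>noise_dichotomy\<close>): if \<open>\<beta> j \<le> \<beta> i\<close>, then either \<open>E\<close> does not depend on
\<open>x j\<close>, or \<open>E\<close> depends on \<open>x j\<close> alone. To see this, let \<open>h\<close> be \<open>1\<^sub>E\<close> minus its average over the \<open>j\<close>-th
coordinate. Replacing coordinate \<open>j\<close> destroys all correlation of \<open>h\<close> with its noisy copy, so the whole
correlation \<open>\<beta> i \<integral> h\<^sup>2\<close> comes from the event, of probability \<open>\<beta> j \<le> \<beta> i\<close>, that \<open>x j\<close> is kept.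
By the Cauchy-Schwarz inequality \<open>h\<close> is then almost surely unchanged by the noise given that event;
since all other coordinates may be replaced at the same time, \<open>h\<close> is a function of \<open>x j\<close>. Thus \<open>1\<^sub>E\<close> is a
sum of a function of \<open>x j\<close> and a function of the other coordinates, and as it takes two values only,
one of the two summands is constant.

The first alternative cannot hold for all \<open>j\<close> with \<open>\<beta> j \<le> \<beta> i\<close> when \<open>0 < \<mu>(A) < 1\<close>. This is proved by
induction on decreasing \<open>\<beta> i\<close>, simultaneously for \<open>R\<close> and its inverse \<open>S\<close>
(\<open>pullback_set_depends_on_one\<close>). For \<open>\<beta> k > \<beta> i\<close> it is already known that \<open>S w k\<close> is a function of a
single \<open>w j\<close> with \<open>\<beta> j = \<beta> k\<close>, hence \<open>j \<noteq> i\<close>. If \<open>E\<close> depended only on these coordinates \<open>x k\<close>, then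
in terms of \<open>w = R x\<close> it would be both the event \<open>w i \<in> A\<close> and independent of \<open>w i\<close>.

Intersecting sets shows that the single coordinate \<open>j\<close> is the same for all \<open>A\<close>, and a countable
point-separating family of sets turns this into \<open>R x i = Q (x j)\<close> (\<open>factors_step\<close>). Comparing \<open>R\<close> with
its inverse shows that \<open>i \<mapsto> j\<close> is a permutation and that \<open>Q\<close> is an isomorphism of flows
(\<open>factor_index_inverse\<close>, \<open>factor_isomorphism\<close>).\<close>

section \<open>Resampling coordinates of a product measure\<close>

text \<open>The family that agrees with \<open>x\<close> on the coordinates in \<open>S\<close> and with \<open>z\<close> on the other coordinates in \<open>I\<close>.\<close>
definition mix :: "'i set \<Rightarrow> 'i set \<Rightarrow> ('i \<Rightarrow> 'a) \<Rightarrow> ('i \<Rightarrow> 'a) \<Rightarrow> 'i \<Rightarrow> 'a" where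
  "mix I S x z = (\<lambda>i\<in>I. if i \<in> S then x i else z i)"

lemma mix_apply: "i \<in> I \<Longrightarrow> mix I S x z i = (if i \<in> S then x i else z i)"
  by (simp add: mix_def)

lemma mix_compl: "mix I (I - S) z x = mix I S x z"
  by (auto simp: mix_def)

lemma mix_eqI: "(\<And>i. i \<in> I \<Longrightarrow> i \<in> S \<Longrightarrow> x i = x' i) \<Longrightarrow> (\<And>i. i \<in> I \<Longrightarrow> i \<notin> S \<Longrightarrow> z i = z' i)
    \<Longrightarrow> mix I S x z = mix I S x' z'"
  by (auto simp: mix_def)

lemma mix_mix_other: "mix I {j} (mix I (I - {j}) x w) z = mix I (I - {j}) z w"
  by (auto simp: mix_def)

lemma measurable_mix [measurable (raw)]:
  assumes f: "f \<in> measurable N (PiM I M)" and g: "g \<in> measurable N (PiM I M)"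
  shows "(\<lambda>w. mix I S (f w) (g w)) \<in> measurable N (PiM I M)"
  unfolding mix_def
proof (rule measurable_restrict)
  fix i assume i: "i \<in> I"
  show "(\<lambda>w. if i \<in> S then f w i else g w i) \<in> measurable N (M i)"
    using measurable_compose[OF f measurable_component_singleton[OF i]]
      measurable_compose[OF g measurable_component_singleton[OF i]] by (cases "i \<in> S") auto
qed

text \<open>A finite product of probability spaces together with the probability \<open>\<beta> i\<close> that the noise keeps the
coordinate \<open>i\<close>.\<close>
locale noise_product = finite_product_prob_space M I
  for M :: "'i \<Rightarrow> 'a measure" and I :: "'i set" +
  fixes \<beta> :: "'i \<Rightarrow> real"
  assumes \<beta>_pos: "i \<in> I \<Longrightarrow> 0 < \<beta> i" and \<beta>_less: "i \<in> I \<Longrightarrow> \<beta> i < 1"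
begin

abbreviation "P \<equiv> PiM I M"

sublocale PP: pair_prob_space P P ..

text \<open>If \<open>x\<close> and \<open>z\<close> are independent with law \<open>P\<close>, then their mixture has law \<open>P\<close> as well.\<close>
lemma distr_mix: "distr (P \<Otimes>\<^sub>M P) P (\<lambda>p. mix I S (fst p) (snd p)) = P"
proof (rule PiM_eqI)
  fix A assume A: "\<And>i. i \<in> I \<Longrightarrow> A i \<in> sets (M i)"
  let ?X = "\<Pi>\<^sub>E i\<in>I. if i \<in> S then A i else space (M i)"
  let ?Z = "\<Pi>\<^sub>E i\<in>I. if i \<in> S then space (M i) else A i"
  have sub: "A i \<subseteq> space (M i)" if "i \<in> I" for i using A[OF that] sets.sets_into_space by auto
  have eq: "(\<lambda>p. mix I S (fst p) (snd p)) -` Pi\<^sub>E I A \<inter> space (P \<Otimes>\<^sub>M P) = ?X \<times> ?Z"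
    using sub
    by (fastforce simp: space_pair_measure space_PiM mix_def PiE_iff extensional_def split: if_splits)
  have "emeasure (distr (P \<Otimes>\<^sub>M P) P (\<lambda>p. mix I S (fst p) (snd p))) (Pi\<^sub>E I A)
      = emeasure (P \<Otimes>\<^sub>M P) (?X \<times> ?Z)"
    using A by (subst emeasure_distr) (auto simp: eq finite_index intro!: sets_PiM_I_finite)
  also have "\<dots> = emeasure P ?X * emeasure P ?Z"
    using A by (intro emeasure_pair_measure_Times sets_PiM_I_finite) (auto simp: finite_index)
  also have "\<dots> = (\<Prod>i\<in>I. emeasure (M i) (if i \<in> S then A i else space (M i)))
      * (\<Prod>i\<in>I. emeasure (M i) (if i \<in> S then space (M i) else A i))"
    using A by (subst (1 2) measure_times) auto
  also have "\<dots> = (\<Prod>i\<in>I. emeasure (M i) (A i))"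
    unfolding prod.distrib[symmetric] by (intro prod.cong) (auto simp: M.emeasure_space_1)
  finally show "emeasure (distr (P \<Otimes>\<^sub>M P) P (\<lambda>p. mix I S (fst p) (snd p))) (Pi\<^sub>E I A)
      = (\<Prod>i\<in>I. emeasure (M i) (A i))" .
qed (simp_all add: finite_index)

lemma AE_mix:
  assumes "AE x in P. Q x"
  shows "AE x in P. AE z in P. Q (mix I S x z)"
proof -
  have "AE p in P \<Otimes>\<^sub>M P. Q (mix I S (fst p) (snd p))"
    by (rule AE_distrD[where M'=P]) (simp, unfold distr_mix, rule assms)
  from PP.AE_pair[OF this] show ?thesis by simp
qed

lemma AE_mix': "AE x in P. Q x \<Longrightarrow> AE z in P. AE x in P. Q (mix I S x z)"
  using AE_mix[of Q "I - S"] by (simp add: mix_compl)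

text \<open>Unlike its converse \<open>AE_mix\<close>, this implication is restricted to measurable properties: a set whose preimage
under \<open>mix\<close> is a null set need not be contained in a measurable null set.\<close>
lemma AE_mixD:
  assumes [measurable]: "Measurable.pred P Q"
    and ae: "AE x in P. AE z in P. Q (mix I S x z)"
  shows "AE x in P. Q x"
proof -
  have "AE p in P \<Otimes>\<^sub>M P. Q (mix I S (fst p) (snd p))"
    by (rule PP.AE_pair_measure) (use ae in auto)
  then have "AE x in distr (P \<Otimes>\<^sub>M P) P (\<lambda>p. mix I S (fst p) (snd p)). Q x"
    by (subst AE_distr_iff) auto
  then show ?thesis unfolding distr_mix .
qed

lemma integrable_bounded:
  assumes "f \<in> borel_measurable P" "\<And>x. \<bar>f x\<bar> \<le> (B::real)"
  shows "integrable P f"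
  by (rule integrable_const_bound[of _ B]) (use assms in auto)

lemma integral_bounded:
  assumes "\<And>x. \<bar>f x\<bar> \<le> (B::real)"
  shows "\<bar>\<integral>x. f x \<partial>P\<bar> \<le> B"
proof (cases "integrable P f")
  case True
  have "\<bar>\<integral>x. f x \<partial>P\<bar> \<le> (\<integral>x. \<bar>f x\<bar> \<partial>P)" using integral_abs_bound by blast
  also have "\<dots> \<le> (\<integral>x. B \<partial>P)" using True assms by (intro integral_mono) auto
  finally show ?thesis by (simp add: P.prob_space)
next
  case False
  have "0 \<le> B" using assms[of undefined] by linarith
  then show ?thesis using False by (simp add: not_integrable_integral_eq)
qed

lemma integral_mix:
  assumes [measurable]: "f \<in> borel_measurable P" and B: "\<And>x. \<bar>f x\<bar> \<le> (B::real)"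
  shows "(\<integral>x. (\<integral>z. f (mix I S x z) \<partial>P) \<partial>P) = (\<integral>x. f x \<partial>P)"
proof -
  have "(\<integral>x. f x \<partial>P) = (\<integral>x. f x \<partial>distr (P \<Otimes>\<^sub>M P) P (\<lambda>p. mix I S (fst p) (snd p)))"
    by (simp add: distr_mix)
  also have "\<dots> = (\<integral>p. f (mix I S (fst p) (snd p)) \<partial>(P \<Otimes>\<^sub>M P))"
    by (subst integral_distr) auto
  also have "\<dots> = (\<integral>x. (\<integral>z. f (mix I S x z) \<partial>P) \<partial>P)"
    by (subst PP.integral_fst'[symmetric]) (auto intro!: PP.P.integrable_const_bound[of _ B] simp: B)
  finally show ?thesis by simp
qed

end

section \<open>The noise operator and its eigensets\<close>

context noise_product
begin

text \<open>The probability that \<open>S\<close> is exactly the set of coordinates that the noise keeps.\<close>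
definition coef :: "'i set \<Rightarrow> real" where
  "coef S = (\<Prod>i\<in>S. \<beta> i) * (\<Prod>i\<in>I - S. 1 - \<beta> i)"

text \<open>The noise operator applied to the indicator function of \<open>E\<close>: the conditional probability, given \<open>x\<close>, that
the noisy copy of \<open>x\<close> lies in \<open>E\<close>.\<close>
definition noise :: "('i \<Rightarrow> 'a) set \<Rightarrow> ('i \<Rightarrow> 'a) \<Rightarrow> real" where
  "noise E x = (\<Sum>S\<in>Pow I. coef S * (\<integral>z. indicator E (mix I S x z) \<partial>P))"

lemma coef_pos: "S \<subseteq> I \<Longrightarrow> 0 < coef S"
  unfolding coef_def using \<beta>_pos \<beta>_less by (intro mult_pos_pos prod_pos) (auto simp: subset_eq)

lemma sum_coef: "(\<Sum>S\<in>Pow I. coef S) = 1"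
  using prod_add[OF finite_index, of \<beta> "\<lambda>i. 1 - \<beta> i"] by (simp add: coef_def)

lemma sum_coef_mem:
  assumes "j \<in> I"
  shows "(\<Sum>S\<in>Pow I. if j \<in> S then coef S else 0) = \<beta> j"
proof -
  \<comment> \<open>Replacing the factor \<open>1 - \<beta> j\<close> by \<open>0\<close> removes exactly the sets without \<open>j\<close> from the binomial expansion.\<close>
  have "(\<Sum>S\<in>Pow I. if j \<in> S then coef S else 0)
      = (\<Sum>S\<in>Pow I. (\<Prod>i\<in>S. \<beta> i) * (\<Prod>i\<in>I - S. if i = j then 0 else 1 - \<beta> i))"
  proof (intro sum.cong refl)
    fix S assume "S \<in> Pow I"
    show "(if j \<in> S then coef S else 0) = (\<Prod>i\<in>S. \<beta> i) * (\<Prod>i\<in>I - S. if i = j then 0 else 1 - \<beta> i)"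
    proof (cases "j \<in> S")
      case True
      then have "(\<Prod>i\<in>I - S. if i = j then 0 else 1 - \<beta> i) = (\<Prod>i\<in>I - S. 1 - \<beta> i)"
        by (intro prod.cong) auto
      with True show ?thesis by (simp add: coef_def)
    next
      case False
      with assms have "(\<Prod>i\<in>I - S. if i = j then 0 else 1 - \<beta> i) = 0"
        using finite_index by (intro prod_zero) auto
      with False show ?thesis by simp
    qed
  qed
  also have "\<dots> = (\<Prod>i\<in>I. \<beta> i + (if i = j then 0 else 1 - \<beta> i))"
    by (rule prod_add[OF finite_index, symmetric])
  also have "\<dots> = (\<Prod>i\<in>I. if i = j then \<beta> i else 1)"
    by (intro prod.cong) auto
  also have "\<dots> = \<beta> j"
    using assms finite_index by (simp add: prod.delta)
  finally show ?thesis .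
qed

lemma measurable_integral_mix [measurable]:
  assumes [measurable]: "f \<in> borel_measurable P"
  shows "(\<lambda>x. \<integral>z. (f (mix I S x z) :: real) \<partial>P) \<in> borel_measurable P"
  by measurable

lemma noise_measurable [measurable]:
  assumes [measurable]: "E \<in> sets P"
  shows "noise E \<in> borel_measurable P"
  unfolding noise_def[abs_def] by measurable

text \<open>The average of the indicator function of \<open>E\<close> over the coordinate \<open>j\<close>; it does not depend on \<open>x j\<close>.\<close>
definition avg :: "'i \<Rightarrow> ('i \<Rightarrow> 'a) set \<Rightarrow> ('i \<Rightarrow> 'a) \<Rightarrow> real" where
  "avg j E x = (\<integral>w. indicator E (mix I (I - {j}) x w) \<partial>P)"

lemma avg_measurable [measurable]:
  assumes [measurable]: "E \<in> sets P"
  shows "avg j E \<in> borel_measurable P"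
  unfolding avg_def by measurable

lemma avg_cong: "(\<And>i. i \<in> I \<Longrightarrow> i \<noteq> j \<Longrightarrow> x i = y i) \<Longrightarrow> avg j E x = avg j E y"
  unfolding avg_def by (intro Bochner_Integration.integral_cong refl arg_cong[where f="indicator E"] mix_eqI) auto

lemma avg_nonneg: "0 \<le> avg j E x"
  unfolding avg_def by (intro integral_nonneg_AE) auto

lemma avg_le_1: "avg j E x \<le> 1"
  using integral_bounded[of "\<lambda>w. indicator E (mix I (I - {j}) x w)" 1]
  unfolding avg_def by (auto simp: indicator_def abs_le_iff)

lemma mult_bound: "\<bar>a\<bar> \<le> 1 \<Longrightarrow> \<bar>b\<bar> \<le> B \<Longrightarrow> \<bar>a * b\<bar> \<le> (B::real)"
  using mult_mono[of "\<bar>a\<bar>" 1 "\<bar>b\<bar>" B] by (simp add: abs_mult)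

lemma avg_bound: "\<bar>avg j E x\<bar> \<le> 1"
  using avg_nonneg[of j E x] avg_le_1[of j E x] by simp

context
  fixes j and E and h :: "('i \<Rightarrow> 'a) \<Rightarrow> real"
  assumes j: "j \<in> I" and E [measurable]: "E \<in> sets P"
  defines "h \<equiv> \<lambda>x. indicator E x - avg j E x"
begin

lemma h_measurable [measurable]: "h \<in> borel_measurable P"
  unfolding h_def by measurable

lemma h_bound: "\<bar>h x\<bar> \<le> 1"
  using avg_nonneg[of j E x] avg_le_1[of j E x] by (auto simp: h_def indicator_def)

text \<open>The function \<open>h\<close> is orthogonal to every function that does not depend on the coordinate \<open>j\<close>.\<close>
lemma h_orthogonal:
  assumes [measurable]: "K \<in> borel_measurable P" and B: "\<And>x. \<bar>K x\<bar> \<le> (B::real)"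
    and K: "\<And>x y. (\<And>i. i \<in> I \<Longrightarrow> i \<noteq> j \<Longrightarrow> x i = y i) \<Longrightarrow> K x = K y"
  shows "(\<integral>x. h x * K x \<partial>P) = 0"
proof -
  let ?m = "mix I (I - {j})"
  have hK: "K (?m x w) = K x" and hq: "avg j E (?m x w) = avg j E x" for x w
    by (auto intro!: K avg_cong simp: mix_apply)
  have "(\<integral>x. h x * K x \<partial>P) = (\<integral>x. (\<integral>w. h (?m x w) * K (?m x w) \<partial>P) \<partial>P)"
    by (rule integral_mix[symmetric, of _ B]) (auto intro!: mult_bound h_bound B)
  also have "\<dots> = (\<integral>x. 0 \<partial>P)"
  proof (rule Bochner_Integration.integral_cong[OF refl])
    fix x assume x[measurable]: "x \<in> space P"
    have "(\<integral>w. h (?m x w) \<partial>P) = (\<integral>w. indicator E (?m x w) - avg j E x \<partial>P)"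
      by (simp add: h_def hq)
    also have "\<dots> = (\<integral>w. indicator E (?m x w) \<partial>P) - (\<integral>w. avg j E x \<partial>P)"
      by (intro Bochner_Integration.integral_diff integrable_bounded[of _ 1]) (auto simp: avg_bound)
    also have "\<dots> = 0" by (simp add: P.prob_space flip: avg_def)
    finally show "(\<integral>w. h (?m x w) * K (?m x w) \<partial>P) = 0" by (simp add: hK)
  qed
  finally show ?thesis by simp
qed

text \<open>The energy argument. Here \<open>V\<close> is the squared norm of \<open>h\<close> and \<open>D S\<close> is the mean square of the change of \<open>h\<close>
when the coordinates outside \<open>S\<close> are resampled. The eigenvalue equation gives that the sum of \<open>coef S * D S\<close>
over the sets \<open>S\<close> containing \<open>j\<close> is \<open>2 V (\<beta> j - b) \<le> 0\<close>. So every such \<open>D S\<close>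
vanishes, and \<open>S = {j}\<close> gives the claim.\<close>
lemma noise_energy:
  assumes b: "\<beta> j \<le> b" and N: "AE x in P. noise E x = c + b * indicator E x"
  shows "AE p in P \<Otimes>\<^sub>M P. h (snd p) = h (mix I {j} (snd p) (fst p))"
proof -
  define V where "V = (\<integral>x. (h x)\<^sup>2 \<partial>P)"
  define H where "H S x = (\<integral>z. h (mix I S x z) \<partial>P)" for S x
  define A where "A S x = (\<integral>z. indicator E (mix I S x z) \<partial>P :: real)" for S x
  define D where "D S = (\<integral>x. (\<integral>z. (h x - h (mix I S x z))\<^sup>2 \<partial>P) \<partial>P)" for S
  have [measurable]: "H S \<in> borel_measurable P" "A S \<in> borel_measurable P" for S
    unfolding H_def[abs_def] A_def[abs_def] by measurable
  have Hb: "\<bar>H S x\<bar> \<le> 1" and Ab: "\<bar>A S x\<bar> \<le> 1" for S x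
    unfolding H_def A_def by (intro integral_bounded h_bound; simp)+
  have int: "integrable P (\<lambda>x. h x * f x)"
    if "f \<in> borel_measurable P" "\<And>x. \<bar>f x\<bar> \<le> 1" for f
    using that by (intro integrable_bounded[of _ 1]) (auto intro!: mult_bound h_bound)
  have ab: "\<bar>avg j E x\<bar> \<le> 1" for x by (rule avg_bound)
  have h0: "(\<integral>x. h x \<partial>P) = 0"
    using h_orthogonal[of "\<lambda>_. 1" 1] by simp
  have hq: "(\<integral>x. h x * avg j E x \<partial>P) = 0"
    by (rule h_orthogonal[of _ 1]) (auto intro!: avg_bound avg_cong)
  have V: "V = (\<integral>x. h x * indicator E x \<partial>P)"
  proof -
    have "V = (\<integral>x. h x * indicator E x - h x * avg j E x \<partial>P)"
      unfolding V_def by (simp add: power2_eq_square h_def algebra_simps)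
    also have "\<dots> = (\<integral>x. h x * indicator E x \<partial>P) - (\<integral>x. h x * avg j E x \<partial>P)"
      by (intro Bochner_Integration.integral_diff int ab) auto
    finally show ?thesis using hq by simp
  qed
  have hA: "(\<integral>x. h x * A S x \<partial>P) = (if j \<in> S then (\<integral>x. h x * H S x \<partial>P) else 0)" for S
  proof (cases "j \<in> S")
    case False
    have "(\<integral>x. h x * A S x \<partial>P) = 0"
    proof (rule h_orthogonal[OF _ Ab])
      fix x y :: "'i \<Rightarrow> 'a" assume "\<And>i. i \<in> I \<Longrightarrow> i \<noteq> j \<Longrightarrow> x i = y i"
      with False have "mix I S x z = mix I S y z" for z by (intro mix_eqI) auto
      then show "A S x = A S y" by (simp add: A_def)
    qed simp
    with False show ?thesis by simp
  next
    case True
    define K where "K x = (\<integral>z. avg j E (mix I S x z) \<partial>P)" for x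
    have [measurable]: "K \<in> borel_measurable P" unfolding K_def[abs_def] by measurable
    have Kb: "\<bar>K x\<bar> \<le> 1" for x unfolding K_def by (intro integral_bounded ab)
    have "(\<integral>x. h x * K x \<partial>P) = 0"
    proof (rule h_orthogonal[OF _ Kb])
      fix x y :: "'i \<Rightarrow> 'a" assume "\<And>i. i \<in> I \<Longrightarrow> i \<noteq> j \<Longrightarrow> x i = y i"
      then have "avg j E (mix I S x z) = avg j E (mix I S y z)" for z
        by (intro avg_cong) (auto simp: mix_apply)
      then show "K x = K y" by (simp add: K_def)
    qed simp
    moreover have HAK: "H S x = A S x - K x" if [measurable]: "x \<in> space P" for x
      unfolding H_def A_def K_def h_def
      by (intro Bochner_Integration.integral_diff integrable_bounded[of _ 1]) (auto simp: ab)
    have "(\<integral>x. h x * H S x \<partial>P) = (\<integral>x. h x * A S x - h x * K x \<partial>P)"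
      by (intro Bochner_Integration.integral_cong refl) (simp add: HAK algebra_simps)
    then have "(\<integral>x. h x * H S x \<partial>P) = (\<integral>x. h x * A S x \<partial>P) - (\<integral>x. h x * K x \<partial>P)"
      by (simp add: int Ab Kb)
    ultimately show ?thesis using True by simp
  qed
  have "b * V = (\<integral>x. h x * noise E x \<partial>P)"
  proof -
    have "(\<integral>x. h x * noise E x \<partial>P) = (\<integral>x. c * h x + b * (h x * indicator E x) \<partial>P)"
      by (rule integral_cong_AE) (use N in \<open>auto simp: algebra_simps\<close>)
    also have "\<dots> = c * (\<integral>x. h x \<partial>P) + b * (\<integral>x. h x * indicator E x \<partial>P)"
      using int[of "\<lambda>_. 1"] int[of "indicator E"] by simp
    finally show ?thesis using h0 V by simp
  qed
  also have "\<dots> = (\<integral>x. (\<Sum>S\<in>Pow I. coef S * (h x * A S x)) \<partial>P)"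
    unfolding noise_def A_def by (simp add: sum_distrib_left mult_ac)
  also have "\<dots> = (\<Sum>S\<in>Pow I. coef S * (\<integral>x. h x * A S x \<partial>P))"
    by (subst Bochner_Integration.integral_sum) (auto intro!: int Ab integrable_mult_right)
  also have "\<dots> = (\<Sum>S\<in>Pow I. if j \<in> S then coef S * (\<integral>x. h x * H S x \<partial>P) else 0)"
    unfolding hA by (intro sum.cong) auto
  finally have bV: "b * V = (\<Sum>S\<in>Pow I. if j \<in> S then coef S * (\<integral>x. h x * H S x \<partial>P) else 0)" .
  have sq: "\<bar>(h x)\<^sup>2\<bar> \<le> 1" for x
    using mult_bound[OF h_bound[of x] h_bound[of x]] by (simp add: power2_eq_square)
  have sq1: "(h x)\<^sup>2 \<le> 1" for x using sq[of x] by simp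
  have D: "D S = 2 * V - 2 * (\<integral>x. h x * H S x \<partial>P)" for S
  proof -
    have "D S = (\<integral>x. (\<integral>z. (h x)\<^sup>2 + (h (mix I S x z))\<^sup>2 - 2 * (h x * h (mix I S x z)) \<partial>P) \<partial>P)"
      unfolding D_def by (simp add: power2_diff mult_ac)
    also have "\<dots> = (\<integral>x. (h x)\<^sup>2 + (\<integral>z. (h (mix I S x z))\<^sup>2 \<partial>P) - 2 * (h x * H S x) \<partial>P)"
    proof (intro Bochner_Integration.integral_cong refl)
      fix x assume [measurable]: "x \<in> space P"
      have "integrable P (\<lambda>z. (h (mix I S x z))\<^sup>2)" "integrable P (\<lambda>z. h x * h (mix I S x z))"
        using sq h_bound by (auto intro!: integrable_bounded[of _ 1] mult_bound simp del: abs_power2)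
      then show "(\<integral>z. (h x)\<^sup>2 + (h (mix I S x z))\<^sup>2 - 2 * (h x * h (mix I S x z)) \<partial>P)
        = (h x)\<^sup>2 + (\<integral>z. (h (mix I S x z))\<^sup>2 \<partial>P) - 2 * (h x * H S x)"
        by (simp add: H_def P.prob_space)
    qed
    also have "\<dots> = V + (\<integral>x. (\<integral>z. (h (mix I S x z))\<^sup>2 \<partial>P) \<partial>P) - 2 * (\<integral>x. h x * H S x \<partial>P)"
    proof -
      have "integrable P (\<lambda>x. (h x)\<^sup>2)" "integrable P (\<lambda>x. \<integral>z. (h (mix I S x z))\<^sup>2 \<partial>P)"
        by (rule integrable_bounded[of _ 1]; (intro integral_bounded)?; (rule sq)?; measurable)+
      then show ?thesis by (simp add: V_def int Hb)
    qed
    also have "(\<integral>x. (\<integral>z. (h (mix I S x z))\<^sup>2 \<partial>P) \<partial>P) = V"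
      unfolding V_def by (rule integral_mix[of _ 1]) (auto simp: sq1)
    finally show ?thesis by simp
  qed
  have D0: "0 \<le> D S" for S unfolding D_def by (intro integral_nonneg_AE) auto
  have V0: "0 \<le> V" unfolding V_def by (intro integral_nonneg_AE) auto
  have "(\<Sum>S\<in>Pow I. if j \<in> S then coef S * D S else 0)
      = (\<Sum>S\<in>Pow I. 2 * V * (if j \<in> S then coef S else 0)
          - 2 * (if j \<in> S then coef S * (\<integral>x. h x * H S x \<partial>P) else 0))"
    unfolding D by (intro sum.cong) (auto simp: algebra_simps)
  also have "\<dots> = 2 * V * \<beta> j - 2 * (b * V)"
    by (simp only: sum_subtractf sum_distrib_left[symmetric] bV sum_coef_mem[OF j])
  also have "\<dots> = 2 * V * (\<beta> j - b)" by (simp add: algebra_simps)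
  also have "\<dots> \<le> 0" using b V0 by (simp add: mult_nonneg_nonpos)
  finally have le: "(\<Sum>S\<in>Pow I. if j \<in> S then coef S * D S else 0) \<le> 0" .
  have nn: "0 \<le> (if j \<in> S then coef S * D S else 0)" if "S \<in> Pow I" for S
    using that D0 coef_pos[of S] by auto
  have "(\<Sum>S\<in>Pow I. if j \<in> S then coef S * D S else 0) = 0"
    by (rule antisym[OF le sum_nonneg]) (use nn in auto)
  then have "\<forall>S\<in>Pow I. (if j \<in> S then coef S * D S else 0) = 0"
    using nn finite_index by (subst (asm) sum_nonneg_eq_0_iff) auto
  from this[rule_format, of "{j}"] have "coef {j} * D {j} = 0" using j by simp
  with coef_pos[of "{j}"] j have D0: "D {j} = 0" by simp
  have bd: "\<bar>(h x - h y)\<^sup>2\<bar> \<le> 4" for x y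
  proof -
    have "\<bar>h x - h y\<bar> \<le> 2" using h_bound[of x] h_bound[of y] by linarith
    then have "\<bar>h x - h y\<bar>\<^sup>2 \<le> 2\<^sup>2" by (intro power_mono) auto
    then show ?thesis by simp
  qed
  let ?f = "\<lambda>p. (h (snd p) - h (mix I {j} (snd p) (fst p)))\<^sup>2"
  have f: "integrable (P \<Otimes>\<^sub>M P) ?f"
    by (rule PP.P.integrable_const_bound[of _ 4]) (use bd in auto)
  have "(\<integral>p. ?f p \<partial>(P \<Otimes>\<^sub>M P)) = D {j}"
    unfolding D_def using PP.integral_snd[of "\<lambda>z x. ?f (z, x)"] f by (simp add: case_prod_unfold)
  then have "AE p in P \<Otimes>\<^sub>M P. ?f p = 0"
    using D0 integral_nonneg_eq_0_iff_AE[OF f] by simp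
  then show ?thesis by simp
qed

end

lemma avg_extreme_iff:
  assumes [measurable]: "E \<in> sets P" "x \<in> space P"
  shows "avg j E x = 1 \<longleftrightarrow> (AE w in P. mix I (I - {j}) x w \<in> E)"
    and "avg j E x = 0 \<longleftrightarrow> (AE w in P. mix I (I - {j}) x w \<notin> E)"
proof -
  let ?F = "{w \<in> space P. mix I (I - {j}) x w \<in> E}"
  have "avg j E x = (\<integral>w. indicator ?F w \<partial>P)"
    unfolding avg_def by (intro Bochner_Integration.integral_cong refl) (auto simp: indicator_def)
  then have eq: "avg j E x = P.prob ?F" by simp
  show "avg j E x = 1 \<longleftrightarrow> (AE w in P. mix I (I - {j}) x w \<in> E)"
    unfolding eq by (rule P.prob_Collect_eq_1) measurable
  show "avg j E x = 0 \<longleftrightarrow> (AE w in P. mix I (I - {j}) x w \<notin> E)"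
    unfolding eq by (rule P.prob_Collect_eq_0) measurable
qed

text \<open>The function \<open>h\<close> depends on \<open>x j\<close> only. Hence the indicator functions of two sections of \<open>E\<close>, taken at fixed
values of the other coordinates, differ by the difference of the averages of these sections. If one average lies
strictly between \<open>0\<close> and \<open>1\<close>, this difference lies strictly between \<open>-1\<close> and \<open>1\<close>; being an integer it is
\<open>0\<close>, so almost all sections agree with that one. If all averages are \<open>0\<close> or \<open>1\<close>, then \<open>E\<close> does not
depend on \<open>x j\<close>.\<close>
lemma noise_dichotomy:
  assumes j: "j \<in> I" and E [measurable]: "E \<in> sets P"
    and b: "\<beta> j \<le> b" and N: "AE x in P. noise E x = c + b * indicator E x"
  shows "(AE x in P. AE w in P. mix I (I - {j}) x w \<in> E \<longleftrightarrow> x \<in> E) \<or>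
    (\<exists>A\<in>sets (M j). AE x in P. x \<in> E \<longleftrightarrow> x j \<in> A)"
proof (cases "AE x in P. avg j E x = 0 \<or> avg j E x = 1")
  case True
  let ?m = "mix I (I - {j})"
  have aw: "avg j E (?m x w) = avg j E x" for x w by (auto intro!: avg_cong simp: mix_apply)
  have *: "AE x in P. AE w in P. ?m x w \<in> E \<longleftrightarrow> avg j E x = 1"
    using True AE_space
  proof eventually_elim
    case (elim x)
    then show ?case
    proof (cases "avg j E x = 1")
      case True
      then have "AE w in P. ?m x w \<in> E" using avg_extreme_iff(1)[OF E elim(2)] by simp
      then show ?thesis by eventually_elim (simp add: True)
    next
      case False
      then have "AE w in P. ?m x w \<notin> E" using avg_extreme_iff(2)[OF E elim(2)] elim(1) by simp
      then show ?thesis by eventually_elim (simp add: False)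
    qed
  qed
  have "AE x in P. x \<in> E \<longleftrightarrow> avg j E x = 1"
    by (rule AE_mixD[where S="I - {j}"]) (use * in \<open>simp_all add: aw\<close>)
  with * have "AE x in P. AE w in P. ?m x w \<in> E \<longleftrightarrow> x \<in> E"
    by eventually_elim simp
  then show ?thesis ..
next
  case False
  let ?m = "mix I (I - {j})"
  have "AE x' in P. AE x in P.
      indicator E x - avg j E x = indicator E (mix I {j} x x') - avg j E (mix I {j} x x')"
    using PP.AE_pair[OF noise_energy[OF j E b N]] by simp
  then have good: "AE x' in P. AE x in P. AE w in P.
      indicator E (?m x w) - avg j E x = indicator E (?m x' w) - avg j E x'"
  proof eventually_elim
    case (elim x')
    from AE_mix[OF this, of "I - {j}"] show ?case
    proof eventually_elim
      case (elim x)
      have "avg j E (?m x w) = avg j E x" "avg j E (mix I {j} (?m x w) x') = avg j E x'" for w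
        by (auto intro!: avg_cong simp: mix_apply)
      with elim show ?case by (simp add: mix_mix_other)
    qed
  qed
  obtain x' where x': "x' \<in> space P" "avg j E x' \<noteq> 0" "avg j E x' \<noteq> 1"
    and gx: "AE x in P. AE w in P.
      indicator E (?m x w) - avg j E x = indicator E (?m x' w) - avg j E x'"
  proof -
    have "\<not> (AE x' in P. \<not> (AE x in P. AE w in P.
        indicator E (?m x w) - avg j E x = indicator E (?m x' w) - avg j E x') \<or>
        avg j E x' = 0 \<or> avg j E x' = 1)"
    proof
      assume "AE x' in P. \<not> (AE x in P. AE w in P.
        indicator E (?m x w) - avg j E x = indicator E (?m x' w) - avg j E x') \<or>
        avg j E x' = 0 \<or> avg j E x' = 1"
      with good have "AE x in P. avg j E x = 0 \<or> avg j E x = 1"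
        by eventually_elim simp
      with False show False ..
    qed
    then have "\<exists>x'\<in>space P. (AE x in P. AE w in P.
        indicator E (?m x w) - avg j E x = indicator E (?m x' w) - avg j E x') \<and>
        avg j E x' \<noteq> 0 \<and> avg j E x' \<noteq> 1"
      using AE_I2[where M=P] by blast
    then show thesis using that by blast
  qed
  \<comment> \<open>The section of \<open>E\<close> over the coordinates of \<open>x'\<close> other than \<open>j\<close>.\<close>
  define A where "A = {u \<in> space (M j). (\<lambda>i\<in>I. if i = j then u else x' i) \<in> E}"
  have [measurable]: "(\<lambda>u. \<lambda>i\<in>I. if i = j then u else x' i) \<in> measurable (M j) P"
  proof (rule measurable_restrict)
    fix i assume "i \<in> I"
    with x'(1) show "(\<lambda>u. if i = j then u else x' i) \<in> measurable (M j) (M i)"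
      by (cases "i = j") (auto simp: space_PiM intro!: measurable_const dest: PiE_mem)
  qed
  have "A \<in> sets (M j)" unfolding A_def by measurable
  have wA: "?m x' w \<in> E \<longleftrightarrow> w j \<in> A" if "w \<in> space P" for w
  proof -
    have "?m x' w = (\<lambda>i\<in>I. if i = j then w j else x' i)" by (auto simp: mix_def)
    moreover have "w j \<in> space (M j)" using that j by (auto simp: space_PiM)
    ultimately show ?thesis by (simp add: A_def)
  qed
  from gx have *: "AE x in P. AE w in P. ?m x w \<in> E \<longleftrightarrow> ?m x w j \<in> A"
  proof eventually_elim
    case (elim x)
    then show ?case
      using AE_space
    proof eventually_elim
      case (elim w)
      have "0 \<le> avg j E x" "avg j E x \<le> 1" "0 < avg j E x'" "avg j E x' < 1"
        using avg_nonneg[of j E x] avg_le_1[of j E x] avg_nonneg[of j E x'] avg_le_1[of j E x'] x' by auto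
      with elim(1) have "?m x w \<in> E \<longleftrightarrow> ?m x' w \<in> E" 
        by (cases "?m x w \<in> E"; cases "?m x' w \<in> E") simp_all
      then show ?case using wA[OF elim(2)] j by (simp add: mix_apply)
    qed
  qed
  have "Measurable.pred P (\<lambda>x. x \<in> E \<longleftrightarrow> x j \<in> A)"
    using \<open>A \<in> sets (M j)\<close> j by measurable
  from AE_mixD[OF this *] \<open>A \<in> sets (M j)\<close> show ?thesis by blast
qed

end

section \<open>Weak limits along the product flow\<close>

lemma L2_bounded:
  assumes "prob_space N" and [measurable]: "f \<in> borel_measurable N" and B: "\<And>x. \<bar>f x\<bar> \<le> B"
  shows "(\<lambda>x. complex_of_real (f x)) \<in> L2 N"
proof -
  interpret prob_space N by fact
  have "integrable N (\<lambda>x. (f x)\<^sup>2)"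
  proof (rule integrable_const_bound[of _ "B\<^sup>2"])
    show "AE x in N. norm ((f x)\<^sup>2) \<le> B\<^sup>2"
      using power_mono[OF B abs_ge_zero, of _ 2] by auto
  qed simp
  then show ?thesis by (simp add: L2_def)
qed

text \<open>The defining limit, for bounded real functions in place of complex square-integrable ones.\<close>
lemma alpha_weakly_mixing_real:
  fixes f g :: "'a \<Rightarrow> real"
  assumes N: "prob_space N" and T: "\<And>t. T t \<in> measurable N N"
    and mix: "alpha_weakly_mixing_along a \<tau> N T"
    and f: "f \<in> borel_measurable N" "\<And>x. \<bar>f x\<bar> \<le> B"
    and g: "g \<in> borel_measurable N" "\<And>x. \<bar>g x\<bar> \<le> B'"
  shows "(\<lambda>n. \<integral>x. f (T (\<tau> n) x) * g x \<partial>N)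
    \<longlonglongrightarrow> a * (\<integral>x. f x \<partial>N) * (\<integral>x. g x \<partial>N) + (1 - a) * (\<integral>x. f x * g x \<partial>N)"
proof -
  interpret prob_space N by fact
  note [measurable] = f(1) g(1) T
  let ?f = "\<lambda>x. complex_of_real (f x)" and ?g = "\<lambda>x. complex_of_real (g x)"
  have ig: "integrable N g" by (rule integrable_const_bound[of _ B']) (use g in auto)
  have "\<bar>f x * g x\<bar> \<le> B * B'" for x
    unfolding abs_mult using f g by (intro mult_mono) (auto intro: order_trans[OF abs_ge_zero])
  then have ifg: "integrable N (\<lambda>x. f x * g x)"
    by (intro integrable_const_bound[of _ "B * B'"]) auto
  have L: "(\<lambda>n. L2_inner N (?f \<circ> T (\<tau> n)) ?g) \<longlonglongrightarrow>
      L2_inner N (\<lambda>x. of_real a * (\<integral>y. ?f y \<partial>N) + of_real (1 - a) * ?f x) ?g"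
    using mix L2_bounded[OF N f] L2_bounded[OF N g]
    unfolding alpha_weakly_mixing_along_def weak_operator_tendsto_def by blast
  have 1: "L2_inner N (?f \<circ> T (\<tau> n)) ?g = of_real (\<integral>x. f (T (\<tau> n) x) * g x \<partial>N)" for n
    unfolding L2_inner_def integral_complex_of_real[symmetric] by simp
  have 2: "(\<integral>x. (a * (\<integral>y. f y \<partial>N) + (1 - a) * f x) * g x \<partial>N)
      = a * (\<integral>x. f x \<partial>N) * (\<integral>x. g x \<partial>N) + (1 - a) * (\<integral>x. f x * g x \<partial>N)"
  proof -
    have "(\<integral>x. (a * (\<integral>y. f y \<partial>N) + (1 - a) * f x) * g x \<partial>N)
        = (\<integral>x. a * (\<integral>y. f y \<partial>N) * g x + (1 - a) * (f x * g x) \<partial>N)"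
      by (simp add: algebra_simps)
    then show ?thesis using ig ifg by simp
  qed
  have 3: "L2_inner N (\<lambda>x. of_real a * (\<integral>y. ?f y \<partial>N) + of_real (1 - a) * ?f x) ?g
      = of_real (\<integral>x. (a * (\<integral>y. f y \<partial>N) + (1 - a) * f x) * g x \<partial>N)"
    unfolding L2_inner_def integral_complex_of_real[symmetric] by simp
  show ?thesis using L unfolding 1 3 tendsto_of_real_iff 2 .
qed

text \<open>A finite product of measure-preserving systems, each of which is \<open>(1 - \<beta> i)\<close>-weakly mixing along \<open>\<tau>\<close>.\<close>
locale product_of_flows = noise_product M I \<beta>
  for M :: "'i \<Rightarrow> 'a measure" and I :: "'i set" and \<beta> :: "'i \<Rightarrow> real" +
  fixes T :: "'i \<Rightarrow> real \<Rightarrow> 'a \<Rightarrow> 'a" and \<tau> :: "nat \<Rightarrow> real"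
  assumes T_mp: "i \<in> I \<Longrightarrow> measure_preserving_map (M i) (M i) (T i t)"
    and T_mixing: "i \<in> I \<Longrightarrow> alpha_weakly_mixing_along (1 - \<beta> i) \<tau> (M i) (T i)"
begin

abbreviation "U \<equiv> product_flow I T"

lemma T_measurable: "i \<in> I \<Longrightarrow> T i t \<in> measurable (M i) (M i)"
  and T_distr: "i \<in> I \<Longrightarrow> distr (M i) (M i) (T i t) = M i"
  using T_mp unfolding measure_preserving_map_def by auto

lemma U_measurable [measurable]: "U t \<in> measurable P P"
  unfolding product_flow_def
proof (rule measurable_restrict)
  fix i assume i: "i \<in> I"
  show "(\<lambda>x. T i t (x i)) \<in> measurable P (M i)"
    by (rule measurable_compose[OF measurable_component_singleton[of i I M, OF i] T_measurable[OF i]])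
qed

lemma U_space: "x \<in> space P \<Longrightarrow> U t x \<in> space P"
  using measurable_space[OF U_measurable] .

lemma rectangle_sets: "(\<And>i. i \<in> I \<Longrightarrow> A i \<in> sets (M i)) \<Longrightarrow> Pi\<^sub>E I A \<in> sets P"
  by (intro sets_PiM_I_finite finite_index)

lemma rectangle_subset: "(\<And>i. i \<in> I \<Longrightarrow> A i \<in> sets (M i)) \<Longrightarrow> i \<in> I \<Longrightarrow> A i \<subseteq> space (M i)"
  using sets.sets_into_space by blast

lemma U_distr: "distr P P (U t) = P"
proof (rule PiM_eqI)
  fix A assume A: "\<And>i. i \<in> I \<Longrightarrow> A i \<in> sets (M i)"
  have V: "T i t -` A i \<inter> space (M i) \<in> sets (M i)" if "i \<in> I" for i
    using T_measurable[OF that] A[OF that] by (rule measurable_sets)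
  have "U t -` Pi\<^sub>E I A \<inter> space P = (\<Pi>\<^sub>E i\<in>I. T i t -` A i \<inter> space (M i))"
    by (auto simp: space_PiM product_flow_def PiE_iff)
  then have "emeasure (distr P P (U t)) (Pi\<^sub>E I A)
      = emeasure P (\<Pi>\<^sub>E i\<in>I. T i t -` A i \<inter> space (M i))"
    using A by (simp add: emeasure_distr rectangle_sets)
  also have "\<dots> = (\<Prod>i\<in>I. emeasure (M i) (T i t -` A i \<inter> space (M i)))"
    using V by (rule measure_times)
  also have "\<dots> = (\<Prod>i\<in>I. emeasure (distr (M i) (M i) (T i t)) (A i))"
    using A T_measurable by (intro prod.cong) (auto simp: emeasure_distr)
  also have "\<dots> = (\<Prod>i\<in>I. emeasure (M i) (A i))"
    using T_distr by (intro prod.cong) auto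
  finally show "emeasure (distr P P (U t)) (Pi\<^sub>E I A) = (\<Prod>i\<in>I. emeasure (M i) (A i))" .
qed (simp_all add: finite_index)

lemma U_prob: "E \<in> sets P \<Longrightarrow> prob {x \<in> space P. U t x \<in> E} = prob E"
  using measure_distr[of "U t" P P E] by (simp add: U_distr vimage_def Int_def conj_commute)

lemma mixing_sets:
  assumes i: "i \<in> I" and A: "A \<in> sets (M i)" and C: "C \<in> sets (M i)"
  shows "(\<lambda>n. M.prob i {u \<in> C. T i (\<tau> n) u \<in> A})
    \<longlonglongrightarrow> (1 - \<beta> i) * M.prob i A * M.prob i C + \<beta> i * M.prob i (A \<inter> C)"
proof -
  note [measurable] = T_measurable[OF i] A C
  have sub: "A \<subseteq> space (M i)" "C \<subseteq> space (M i)" using sets.sets_into_space[OF A] sets.sets_into_space[OF C] .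
  have "(\<integral>x. indicator A (T i t x) * indicator C x \<partial>M i :: real) = M.prob i {u \<in> C. T i t u \<in> A}" for t
  proof -
    have "(\<integral>x. indicator A (T i t x) * indicator C x \<partial>M i :: real)
        = (\<integral>x. indicator {u \<in> C. T i t u \<in> A} x \<partial>M i)"
      by (intro Bochner_Integration.integral_cong refl) (auto simp: indicator_def)
    then show ?thesis using sub by (simp add: Int_absorb2 subset_eq)
  qed
  moreover have "(\<integral>x. indicator A x * indicator C x \<partial>M i :: real) = M.prob i (A \<inter> C)"
    using sub by (simp add: indicator_inter_arith[symmetric] Int_absorb2 le_infI1)
  ultimately show ?thesis
    using alpha_weakly_mixing_real[OF prob_space T_measurable[OF i] T_mixing[OF i],
        of "indicator A" 1 "indicator C" 1] sub
    by (simp add: Int_absorb2)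
qed

text \<open>The probability that a random point lies in \<open>G\<close> and its noisy copy lies in \<open>E\<close>.\<close>
definition joint :: "('i \<Rightarrow> 'a) set \<Rightarrow> ('i \<Rightarrow> 'a) set \<Rightarrow> real" where
  "joint G E = (\<Sum>S\<in>Pow I. coef S * PP.prob {p \<in> space (P \<Otimes>\<^sub>M P). fst p \<in> G \<and> mix I S (fst p) (snd p) \<in> E})"

lemma joint_rectangle:
  assumes A: "\<And>i. i \<in> I \<Longrightarrow> A i \<in> sets (M i)" and C: "\<And>i. i \<in> I \<Longrightarrow> C i \<in> sets (M i)"
  shows "joint (Pi\<^sub>E I C) (Pi\<^sub>E I A)
    = (\<Prod>i\<in>I. \<beta> i * M.prob i (A i \<inter> C i) + (1 - \<beta> i) * M.prob i (A i) * M.prob i (C i))"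
proof -
  have "PP.prob {p \<in> space (P \<Otimes>\<^sub>M P). fst p \<in> Pi\<^sub>E I C \<and> mix I S (fst p) (snd p) \<in> Pi\<^sub>E I A}
      = (\<Prod>i\<in>S. M.prob i (A i \<inter> C i)) * (\<Prod>i\<in>I - S. M.prob i (A i) * M.prob i (C i))"
    if S: "S \<in> Pow I" for S
  proof -
    let ?X = "\<Pi>\<^sub>E i\<in>I. if i \<in> S then A i \<inter> C i else C i"
    let ?Z = "\<Pi>\<^sub>E i\<in>I. if i \<in> S then space (M i) else A i"
    have "{p \<in> space (P \<Otimes>\<^sub>M P). fst p \<in> Pi\<^sub>E I C \<and> mix I S (fst p) (snd p) \<in> Pi\<^sub>E I A} = ?X \<times> ?Z"
      using rectangle_subset[of A, OF A] rectangle_subset[of C, OF C]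
      by (fastforce simp: space_pair_measure space_PiM mix_def PiE_iff extensional_def split: if_splits)
    moreover have "emeasure (P \<Otimes>\<^sub>M P) (?X \<times> ?Z) = emeasure P ?X * emeasure P ?Z"
      using A C by (intro emeasure_pair_measure_Times rectangle_sets) auto
    then have "PP.prob (?X \<times> ?Z) = prob ?X * prob ?Z"
      by (simp add: measure_def enn2real_mult)
    moreover have "prob ?X = (\<Prod>i\<in>I. M.prob i (if i \<in> S then A i \<inter> C i else C i))"
      using A C by (intro prob_times) auto
    moreover have "prob ?Z = (\<Prod>i\<in>I. M.prob i (if i \<in> S then space (M i) else A i))"
      using A C by (intro prob_times) auto
    ultimately have "PP.prob {p \<in> space (P \<Otimes>\<^sub>M P). fst p \<in> Pi\<^sub>E I C \<and> mix I S (fst p) (snd p) \<in> Pi\<^sub>E I A}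
        = (\<Prod>i\<in>I. if i \<in> S then M.prob i (A i \<inter> C i) else M.prob i (A i) * M.prob i (C i))"
      by (simp add: prod.distrib[symmetric] if_distrib M.prob_space cong: if_cong)
         (intro prod.cong; simp add: M.prob_space)
    also have "\<dots> = (\<Prod>i\<in>S. M.prob i (A i \<inter> C i)) * (\<Prod>i\<in>I - S. M.prob i (A i) * M.prob i (C i))"
      using S finite_index
      by (subst prod.If_cases) (auto simp: Int_absorb1 Diff_eq intro!: arg_cong2[where f="(*)"] prod.cong)
    finally show ?thesis .
  qed
  then have "joint (Pi\<^sub>E I C) (Pi\<^sub>E I A) = (\<Sum>S\<in>Pow I. (\<Prod>i\<in>S. \<beta> i * M.prob i (A i \<inter> C i))
      * (\<Prod>i\<in>I - S. (1 - \<beta> i) * M.prob i (A i) * M.prob i (C i)))"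
    unfolding joint_def coef_def by (intro sum.cong) (auto simp: prod.distrib mult_ac)
  then show ?thesis by (simp add: prod_add[OF finite_index])
qed

lemma rectangle_limit:
  assumes A: "\<And>i. i \<in> I \<Longrightarrow> A i \<in> sets (M i)" and C: "\<And>i. i \<in> I \<Longrightarrow> C i \<in> sets (M i)"
  shows "(\<lambda>n. prob {x \<in> Pi\<^sub>E I C. U (\<tau> n) x \<in> Pi\<^sub>E I A}) \<longlonglongrightarrow> joint (Pi\<^sub>E I C) (Pi\<^sub>E I A)"
proof -
  have "prob {x \<in> Pi\<^sub>E I C. U t x \<in> Pi\<^sub>E I A} = (\<Prod>i\<in>I. M.prob i {u \<in> C i. T i t u \<in> A i})" for t
  proof -
    have "{u \<in> C i. T i t u \<in> A i} = C i \<inter> (T i t -` A i \<inter> space (M i))" if "i \<in> I" for i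
      using rectangle_subset[of C, OF C that] by auto
    then have "{u \<in> C i. T i t u \<in> A i} \<in> sets (M i)" if "i \<in> I" for i
      using that C measurable_sets[OF T_measurable[OF that] A[OF that]] by simp
    moreover have "{x \<in> Pi\<^sub>E I C. U t x \<in> Pi\<^sub>E I A} = (\<Pi>\<^sub>E i\<in>I. {u \<in> C i. T i t u \<in> A i})"
      by (auto simp: product_flow_def PiE_iff extensional_def)
    ultimately show ?thesis by (simp add: prob_times)
  qed
  moreover have "joint (Pi\<^sub>E I C) (Pi\<^sub>E I A)
      = (\<Prod>i\<in>I. (1 - \<beta> i) * M.prob i (A i) * M.prob i (C i) + \<beta> i * M.prob i (A i \<inter> C i))"
    by (subst joint_rectangle) (auto simp: A C add.commute)
  ultimately show ?thesis
    using mixing_sets[OF _ A C] by (auto intro!: tendsto_prod)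
qed

lemma joint_space: "G \<in> sets P \<Longrightarrow> joint G (space P) = prob G"
proof -
  assume G: "G \<in> sets P"
  then have sub: "G \<subseteq> space P" by (rule sets.sets_into_space)
  have "PP.prob {p \<in> space (P \<Otimes>\<^sub>M P). fst p \<in> G \<and> mix I S (fst p) (snd p) \<in> space P} = prob G" for S
  proof -
    have m: "mix I S (fst p) (snd p) \<in> space P" if "p \<in> space (P \<Otimes>\<^sub>M P)" for p
    proof -
      have "(\<lambda>p. mix I S (fst p) (snd p)) \<in> measurable (P \<Otimes>\<^sub>M P) P" by measurable
      from measurable_space[OF this that] show ?thesis .
    qed
    have "{p \<in> space (P \<Otimes>\<^sub>M P). fst p \<in> G \<and> mix I S (fst p) (snd p) \<in> space P} = G \<times> space P"
      using sub m by (auto simp: space_pair_measure)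
    moreover have "emeasure (P \<Otimes>\<^sub>M P) (G \<times> space P) = emeasure P G"
      using G by (subst emeasure_pair_measure_Times) (auto simp: P.emeasure_space_1)
    ultimately show ?thesis by (simp add: measure_def)
  qed
  then show ?thesis
    unfolding joint_def by (simp add: sum_distrib_right[symmetric] sum_coef)
qed

text \<open>The rectangles \<open>E\<close> generate the product sigma-algebra, and the sets \<open>E\<close> for which the limit holds form a
Dynkin system. For disjoint unions, the \<open>k\<close>-th term is at most the measure of \<open>F k\<close> because the flow
preserves \<open>P\<close>, so limit and sum may be interchanged.\<close>
lemma flow_limit:
  assumes E: "E \<in> sets P" and C: "\<And>i. i \<in> I \<Longrightarrow> C i \<in> sets (M i)"
  shows "(\<lambda>n. prob {x \<in> Pi\<^sub>E I C. U (\<tau> n) x \<in> E}) \<longlonglongrightarrow> joint (Pi\<^sub>E I C) E"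
proof -
  let ?G = "Pi\<^sub>E I C" and ?R = "{Pi\<^sub>E I A |A. \<forall>i\<in>I. A i \<in> sets (M i)}"
  have G[measurable]: "?G \<in> sets P" using C by (rule rectangle_sets)
  have Gs: "?G \<subseteq> space P" using G by (rule sets.sets_into_space)
  have sP: "sets P = sigma_sets (space P) ?R"
    unfolding sets_PiM prod_algebra_eq_finite[OF finite_index] space_PiM
    by (rule arg_cong[where f="sigma_sets _"]) (auto simp: Pi_iff)
  have "Int_stable ?R" by (rule Int_stable_PiE)
  moreover have "?R \<subseteq> Pow (space P)"
    using rectangle_sets sets.sets_into_space by fastforce
  ultimately show ?thesis using E unfolding sP
  proof (induction rule: sigma_sets_induct_disjoint)
    case (basic A)
    then show ?case using rectangle_limit[OF _ C] by auto
  next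
    case empty
    then show ?case by (simp add: joint_def)
  next
    case (compl E)
    then have E[measurable]: "E \<in> sets P" by (simp add: sP)
    have "prob {x \<in> ?G. U t x \<in> space P - E} = prob ?G - prob {x \<in> ?G. U t x \<in> E}" for t
    proof -
      have "{x \<in> ?G. U t x \<in> space P - E} = ?G - {x \<in> ?G. U t x \<in> E}"
        using Gs U_space by auto
      moreover have "{x \<in> ?G. U t x \<in> E} = ?G \<inter> {x \<in> space P. U t x \<in> E}" using Gs by auto
      then have "{x \<in> ?G. U t x \<in> E} \<in> sets P" by simp
      ultimately show ?thesis by (simp add: finite_measure_Diff)
    qed
    moreover have "joint ?G (space P - E) = prob ?G - joint ?G E"
    proof -
      have "PP.prob {p \<in> space (P \<Otimes>\<^sub>M P). fst p \<in> ?G \<and> mix I S (fst p) (snd p) \<in> space P - E}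
        = PP.prob {p \<in> space (P \<Otimes>\<^sub>M P). fst p \<in> ?G \<and> mix I S (fst p) (snd p) \<in> space P}
          - PP.prob {p \<in> space (P \<Otimes>\<^sub>M P). fst p \<in> ?G \<and> mix I S (fst p) (snd p) \<in> E}" for S
        using sets.sets_into_space[OF E]
        by (subst PP.P.finite_measure_Diff[symmetric]) (auto intro!: arg_cong[where f=PP.prob])
      then show ?thesis
        unfolding joint_space[OF G, symmetric]
        by (simp add: joint_def right_diff_distrib sum_subtractf)
    qed
    ultimately show ?case using compl.IH by (simp add: tendsto_diff)
  next
    case (union F)
    then have F[measurable]: "F k \<in> sets P" for k by (auto simp: sP)
    have set_eq: "{x \<in> ?G. U t x \<in> E} = ?G \<inter> {x \<in> space P. U t x \<in> E}" for t E using Gs by auto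
    have m: "{x \<in> ?G. U t x \<in> E} \<in> sets P" if [measurable]: "E \<in> sets P" for t E
      unfolding set_eq by measurable
    have 1: "(\<lambda>k. prob {x \<in> ?G. U t x \<in> F k}) sums prob {x \<in> ?G. U t x \<in> (\<Union>k. F k)}" for t
    proof -
      have "{x \<in> ?G. U t x \<in> (\<Union>k. F k)} = (\<Union>k. {x \<in> ?G. U t x \<in> F k})" by auto
      moreover have "disjoint_family (\<lambda>k. {x \<in> ?G. U t x \<in> F k})"
        using union(1) by (auto simp: disjoint_family_on_def)
      ultimately show ?thesis using m[OF F] by (simp add: finite_measure_UNION image_subset_iff)
    qed
    have le: "prob {x \<in> ?G. U t x \<in> F k} \<le> prob (F k)" for t k
    proof -
      have "prob {x \<in> ?G. U t x \<in> F k} \<le> prob {x \<in> space P. U t x \<in> F k}"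
        using Gs by (intro finite_measure_mono) auto
      then show ?thesis by (simp add: U_prob)
    qed
    have 2: "(\<lambda>k. joint ?G (F k)) sums joint ?G (\<Union>k. F k)"
      unfolding joint_def
    proof (intro sums_sum sums_mult)
      fix S
      let ?f = "\<lambda>E. {p \<in> space (P \<Otimes>\<^sub>M P). fst p \<in> ?G \<and> mix I S (fst p) (snd p) \<in> E}"
      have "?f (\<Union>k. F k) = (\<Union>k. ?f (F k))" by auto
      moreover have "disjoint_family (\<lambda>k. ?f (F k))"
        using union(1) by (auto simp: disjoint_family_on_def)
      moreover have "range (\<lambda>k. ?f (F k)) \<subseteq> sets (P \<Otimes>\<^sub>M P)" by auto
      ultimately show "(\<lambda>k. PP.prob (?f (F k))) sums PP.prob (?f (\<Union>k. F k))"
        using PP.P.finite_measure_UNION[of "\<lambda>k. ?f (F k)"] by simp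
    qed
    have sm: "summable (\<lambda>k. prob (F k))"
    proof -
      have "range F \<subseteq> sets P" using F by blast
      from finite_measure_UNION[OF this union(1)] show ?thesis by (rule sums_summable)
    qed
    have "(\<lambda>n. \<Sum>k. prob {x \<in> ?G. U (\<tau> n) x \<in> F k}) \<longlonglongrightarrow> (\<Sum>k. joint ?G (F k))"
    proof (rule tannerys_theorem[OF _ _ sm, THEN conjunct2, THEN conjunct2])
      show "(\<lambda>n. prob {x \<in> ?G. U (\<tau> n) x \<in> F k}) \<longlonglongrightarrow> joint ?G (F k)" for k
        by (rule union.IH)
      show "\<forall>\<^sub>F (k, n) in sequentially \<times>\<^sub>F sequentially.
          norm (prob {x \<in> ?G. U (\<tau> n) x \<in> F k}) \<le> prob (F k)"
        using le by (intro always_eventually) simp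
    qed simp
    with 1 2 show ?case by (simp add: sums_iff)
  qed
qed

end

section \<open>The eigenvalue equation for maps commuting with the flow\<close>

context noise_product
begin

lemma noise_nonneg: "0 \<le> noise E x"
  unfolding noise_def
  by (intro sum_nonneg mult_nonneg_nonneg integral_nonneg_AE) (auto intro: less_imp_le coef_pos)

lemma noise_le_1: "noise E x \<le> 1"
proof -
  have "noise E x \<le> (\<Sum>S\<in>Pow I. coef S * 1)"
    unfolding noise_def
  proof (intro sum_mono mult_left_mono)
    fix S
    show "(\<integral>z. indicator E (mix I S x z) \<partial>P) \<le> (1::real)"
      using integral_bounded[of "\<lambda>z. indicator E (mix I S x z)" 1] by (auto simp: abs_le_iff)
  qed (auto intro: less_imp_le coef_pos)
  then show ?thesis by (simp add: sum_coef)
qed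

lemma noise_cong_AE:
  assumes [measurable]: "E \<in> sets P" "F \<in> sets P" and eq: "AE x in P. x \<in> E \<longleftrightarrow> x \<in> F"
  shows "AE x in P. noise E x = noise F x"
proof -
  have "AE x in P. \<forall>S\<in>Pow I. AE z in P. mix I S x z \<in> E \<longleftrightarrow> mix I S x z \<in> F"
    using AE_mix[OF eq] finite_index by (intro AE_finite_allI) auto
  with AE_space show ?thesis
  proof eventually_elim
    case (elim x)
    note [measurable] = elim(1)
    show ?case
      unfolding noise_def
    proof (intro sum.cong refl arg_cong[where f="(*) _"] integral_cong_AE)
      fix S assume "S \<in> Pow I"
      with elim(2) have "AE z in P. mix I S x z \<in> E \<longleftrightarrow> mix I S x z \<in> F" by blast
      then show "AE z in P. indicat_real E (mix I S x z) = indicator F (mix I S x z)"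
        by eventually_elim (simp add: indicator_def)
    qed measurable
  qed
qed

text \<open>Bounded densities are determined by their integrals over rectangles.\<close>
lemma AE_eq_of_rectangles:
  fixes f g :: "('i \<Rightarrow> 'a) \<Rightarrow> real"
  assumes [measurable]: "f \<in> borel_measurable P" "g \<in> borel_measurable P"
    and f: "\<And>x. 0 \<le> f x" "\<And>x. f x \<le> B" and g: "\<And>x. 0 \<le> g x" "\<And>x. g x \<le> B"
    and eq: "\<And>C. (\<And>i. i \<in> I \<Longrightarrow> C i \<in> sets (M i)) \<Longrightarrow>
      (\<integral>x. indicator (Pi\<^sub>E I C) x * f x \<partial>P) = (\<integral>x. indicator (Pi\<^sub>E I C) x * g x \<partial>P)"
  shows "AE x in P. f x = g x"
proof -
  have em: "emeasure (density P (\<lambda>x. ennreal (h x))) G = ennreal (\<integral>x. indicator G x * h x \<partial>P)"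
    if [measurable]: "G \<in> sets P" "h \<in> borel_measurable P" and h: "\<And>x. 0 \<le> h x" "\<And>x. h x \<le> B"
    for G and h :: "('i \<Rightarrow> 'a) \<Rightarrow> real"
  proof -
    have "\<bar>indicator G x * h x\<bar> \<le> B" for x
      using h[of x] by (auto simp: indicator_def)
    then have int: "integrable P (\<lambda>x. indicator G x * h x)"
      by (intro integrable_bounded[of _ B]) auto
    have "emeasure (density P (\<lambda>x. ennreal (h x))) G = (\<integral>\<^sup>+x. ennreal (indicator G x * h x) \<partial>P)"
      by (subst emeasure_density) (auto intro!: nn_integral_cong simp: indicator_def)
    also have "\<dots> = ennreal (\<integral>x. indicator G x * h x \<partial>P)"
      using int h by (intro nn_integral_eq_integral) auto
    finally show ?thesis .
  qed
  have "density P (\<lambda>x. ennreal (f x)) = density P (\<lambda>x. ennreal (g x))"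
  proof (rule measure_eqI_PiM_finite[OF finite_index])
    fix C assume C: "\<And>i. i \<in> I \<Longrightarrow> C i \<in> sets (M i)"
    then have "Pi\<^sub>E I C \<in> sets P" by (intro sets_PiM_I_finite finite_index)
    then show "emeasure (density P (\<lambda>x. ennreal (f x))) (Pi\<^sub>E I C)
        = emeasure (density P (\<lambda>x. ennreal (g x))) (Pi\<^sub>E I C)"
      using eq[OF C] f g by (simp add: em)
  next
    show "range (\<lambda>n::nat. \<Pi>\<^sub>E i\<in>I. space (M i)) \<subseteq> prod_algebra I M"
      using space_in_prod_algebra by auto
    show "emeasure (density P (\<lambda>x. ennreal (f x))) (\<Pi>\<^sub>E i\<in>I. space (M i)) \<noteq> \<infinity>"
      using f by (subst em) (auto simp flip: space_PiM)
  qed (auto simp: space_PiM)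
  then have "AE x in P. ennreal (f x) = ennreal (g x)"
    by (intro density_unique) auto
  then show ?thesis
    by eventually_elim (simp add: f g)
qed

lemma measurable_section_integral:
  assumes G: "G \<in> sets P"
  shows "(\<lambda>u. \<integral>z. indicator G (\<lambda>k\<in>I. if k = i then u else z k) \<partial>P :: real) \<in> borel_measurable (M i)"
proof -
  have m: "(\<lambda>p. \<lambda>k\<in>I. if k = i then fst p else snd p k) \<in> measurable (M i \<Otimes>\<^sub>M P) P"
  proof (rule measurable_restrict)
    fix k assume k: "k \<in> I"
    show "(\<lambda>p. if k = i then fst p else snd p k) \<in> measurable (M i \<Otimes>\<^sub>M P) (M k)"
      using k by (cases "k = i") auto
  qed
  have "(\<lambda>p. indicator G (\<lambda>k\<in>I. if k = i then fst p else snd p k)) \<in> borel_measurable (M i \<Otimes>\<^sub>M P)"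
    using measurable_compose[OF m borel_measurable_indicator[OF G]] .
  from borel_measurable_lebesgue_integral[of "\<lambda>u z. indicator G (\<lambda>k\<in>I. if k = i then u else z k)"] this
  show ?thesis by (simp add: case_prod_unfold)
qed

text \<open>Conditioning on the coordinate \<open>i\<close>; the inner integral is the conditional probability of \<open>G\<close> given \<open>w i = u\<close>.\<close>
lemma integral_component_mult:
  assumes i: "i \<in> I" and G[measurable]: "G \<in> sets P"
    and \<phi>[measurable]: "\<phi> \<in> borel_measurable (M i)" and b: "\<And>u. \<bar>\<phi> u\<bar> \<le> (1::real)"
  shows "(\<integral>w. \<phi> (w i) * indicator G w \<partial>P)
    = (\<integral>u. \<phi> u * (\<integral>z. indicator G (\<lambda>k\<in>I. if k = i then u else z k) \<partial>P) \<partial>M i)"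
proof -
  let ?g = "\<lambda>u. \<integral>z. indicator G (\<lambda>k\<in>I. if k = i then u else z k) \<partial>P :: real"
  note [measurable] = measurable_section_integral[OF G]
  have c[measurable]: "(\<lambda>x. x i) \<in> measurable P (M i)" using i by simp
  have "(\<integral>w. \<phi> (w i) * indicator G w \<partial>P)
      = (\<integral>x. (\<integral>z. \<phi> (mix I {i} x z i) * indicator G (mix I {i} x z) \<partial>P) \<partial>P)"
    by (rule integral_mix[symmetric, of _ 1]) (auto simp: indicator_def b)
  also have "\<dots> = (\<integral>x. \<phi> (x i) * ?g (x i) \<partial>P)"
  proof (intro Bochner_Integration.integral_cong refl)
    fix x :: "'i \<Rightarrow> 'a"
    have "mix I {i} x z = (\<lambda>k\<in>I. if k = i then x i else z k)" for z by (auto simp: mix_def)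
    then show "(\<integral>z. \<phi> (mix I {i} x z i) * indicator G (mix I {i} x z) \<partial>P) = \<phi> (x i) * ?g (x i)"
      using i by (simp add: if_distrib cong: if_cong)
  qed
  also have "\<dots> = (\<integral>u. \<phi> u * ?g u \<partial>distr P (M i) (\<lambda>x. x i))"
    by (subst integral_distr) auto
  finally show ?thesis by (simp add: PiM_component i)
qed

end

context product_of_flows
begin

lemma joint_eq_integral:
  assumes [measurable]: "G \<in> sets P" "E \<in> sets P"
  shows "joint G E = (\<integral>x. indicator G x * noise E x \<partial>P)"
proof -
  have "PP.prob {p \<in> space (P \<Otimes>\<^sub>M P). fst p \<in> G \<and> mix I S (fst p) (snd p) \<in> E}
      = (\<integral>x. indicator G x * (\<integral>z. indicator E (mix I S x z) \<partial>P) \<partial>P)" for S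
  proof -
    let ?D = "{p \<in> space (P \<Otimes>\<^sub>M P). fst p \<in> G \<and> mix I S (fst p) (snd p) \<in> E}"
    let ?f = "\<lambda>p. indicator G (fst p) * indicator E (mix I S (fst p) (snd p)) :: real"
    have "PP.prob ?D = (\<integral>p. indicator ?D p \<partial>(P \<Otimes>\<^sub>M P))" by simp
    also have "\<dots> = (\<integral>p. ?f p \<partial>(P \<Otimes>\<^sub>M P))"
      by (intro Bochner_Integration.integral_cong refl) (auto simp: indicator_def)
    also have "\<dots> = (\<integral>x. (\<integral>z. ?f (x, z) \<partial>P) \<partial>P)"
      by (subst PP.integral_fst'[symmetric])
         (auto intro!: PP.P.integrable_const_bound[of _ 1] simp: indicator_def)
    finally show ?thesis by simp
  qed
  moreover have "integrable P (\<lambda>x. indicator G x * (\<integral>z. indicator E (mix I S x z) \<partial>P) :: real)" for S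
  proof (rule integrable_bounded[of _ 1])
    fix x
    have "\<bar>\<integral>z. indicator E (mix I S x z) \<partial>P\<bar> \<le> (1::real)"
      by (intro integral_bounded) (auto simp: indicator_def)
    then show "\<bar>indicator G x * (\<integral>z. indicator E (mix I S x z) \<partial>P)\<bar> \<le> (1::real)"
      by (auto simp: indicator_def)
  qed measurable
  ultimately show ?thesis
    unfolding joint_def noise_def
    by (simp add: sum_distrib_left mult.left_commute[of "indicator G _"])
qed

lemma component_limit:
  assumes i: "i \<in> I" and A[measurable]: "A \<in> sets (M i)" and G[measurable]: "G \<in> sets P"
  shows "(\<lambda>n. prob {w \<in> space P. T i (\<tau> n) (w i) \<in> A \<and> w \<in> G})
    \<longlonglongrightarrow> (1 - \<beta> i) * M.prob i A * prob G + \<beta> i * prob {w \<in> space P. w i \<in> A \<and> w \<in> G}"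
proof -
  let ?g = "\<lambda>u. \<integral>z. indicator G (\<lambda>k\<in>I. if k = i then u else z k) \<partial>P :: real"
  note T[measurable] = T_measurable[OF i]
  have pr: "prob {w \<in> space P. \<phi> (w i) \<in> A \<and> w \<in> G} = (\<integral>u. indicator A (\<phi> u) * ?g u \<partial>M i)"
    if [measurable]: "\<phi> \<in> measurable (M i) (M i)" for \<phi>
  proof -
    have "prob {w \<in> space P. \<phi> (w i) \<in> A \<and> w \<in> G}
        = (\<integral>w. indicator {w \<in> space P. \<phi> (w i) \<in> A \<and> w \<in> G} w \<partial>P)"
      by (simp add: Int_absorb2 subset_eq)
    also have "\<dots> = (\<integral>w. indicator A (\<phi> (w i)) * indicator G w \<partial>P)"
      by (intro Bochner_Integration.integral_cong refl) (auto simp: indicator_def)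
    also have "\<dots> = (\<integral>u. indicator A (\<phi> u) * ?g u \<partial>M i)"
      by (rule integral_component_mult[OF i G]) (auto simp: indicator_def)
    finally show ?thesis .
  qed
  have pG: "prob G = (\<integral>u. ?g u \<partial>M i)"
  proof -
    have "prob G = (\<integral>w. 1 * indicator G w \<partial>P)" using G by simp
    also have "\<dots> = (\<integral>u. 1 * ?g u \<partial>M i)"
      by (rule integral_component_mult[OF i G]) auto
    finally show ?thesis by simp
  qed
  have gm: "?g \<in> borel_measurable (M i)" by (rule measurable_section_integral[OF G])
  have gb: "\<bar>?g u\<bar> \<le> 1" for u by (intro integral_bounded) (auto simp: indicator_def)
  have "(\<lambda>n. \<integral>u. indicator A (T i (\<tau> n) u) * ?g u \<partial>M i)
    \<longlonglongrightarrow> (1 - \<beta> i) * (\<integral>u. indicator A u \<partial>M i) * (\<integral>u. ?g u \<partial>M i)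
      + (1 - (1 - \<beta> i)) * (\<integral>u. indicator A u * ?g u \<partial>M i)"
    by (rule alpha_weakly_mixing_real[OF prob_space T T_mixing[OF i] _ _ gm gb, of _ 1])
       (auto simp: indicator_def)
  then show ?thesis
    using pr[OF T] pr[of "\<lambda>u. u"] pG sets.sets_into_space[OF A] by (simp add: Int_absorb2)
qed

text \<open>Two measure-preserving maps, inverse to each other modulo null sets, that commute with the product flow.\<close>
definition conjugate_pair :: "(('i \<Rightarrow> 'a) \<Rightarrow> 'i \<Rightarrow> 'a) \<Rightarrow> (('i \<Rightarrow> 'a) \<Rightarrow> 'i \<Rightarrow> 'a) \<Rightarrow> bool" where
  "conjugate_pair R S \<longleftrightarrow>
     R \<in> measurable P P \<and> distr P P R = P \<and> S \<in> measurable P P \<and> distr P P S = P \<and>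
     (AE x in P. R (S x) = x) \<and> (AE x in P. S (R x) = x) \<and>
     (\<forall>t. AE x in P. R (U t x) = U t (R x)) \<and> (\<forall>t. AE x in P. S (U t x) = U t (S x))"

lemma conjugate_pair_sym: "conjugate_pair R S \<Longrightarrow> conjugate_pair S R"
  unfolding conjugate_pair_def by blast

lemma conjugate_pair_id: "conjugate_pair (\<lambda>x. x) (\<lambda>x. x)"
  unfolding conjugate_pair_def by (simp add: distr_id2)

lemma AE_transport:
  assumes "R \<in> measurable P P" "distr P P R = P" and Q: "AE x in P. Q x"
  shows "AE x in P. Q (R x)"
proof (rule AE_distrD[OF assms(1)])
  show "AE x in distr P P R. Q x" unfolding assms(2) by (rule Q)
qed

text \<open>Both sides are limits of the same sequence. The measure of the points of \<open>G\<close> that the flow moves into \<open>E\<close>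
converges to \<open>joint G E\<close>. The substitution \<open>x = S w\<close> turns this measure into that of the \<open>w\<close> with
\<open>S w \<in> G\<close> that the flow moves into \<open>{w. w i \<in> A}\<close>, where only the weak limit on the \<open>i\<close>-th factor enters.\<close>
lemma noise_pullback:
  assumes RS: "conjugate_pair R S" and i: "i \<in> I" and A[measurable]: "A \<in> sets (M i)"
  defines "E \<equiv> {x \<in> space P. R x i \<in> A}"
  shows "AE x in P. noise E x = (1 - \<beta> i) * M.prob i A + \<beta> i * indicator E x"
proof -
  have R[measurable]: "R \<in> measurable P P" and S[measurable]: "S \<in> measurable P P"
    and dS: "distr P P S = P" and RSx: "AE x in P. R (S x) = x"
    using RS by (auto simp: conjugate_pair_def)
  have SR: "conjugate_pair S R" by (rule conjugate_pair_sym[OF RS])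
  note T[measurable] = T_measurable[OF i]
  have c[measurable]: "(\<lambda>x. x i) \<in> measurable P (M i)" using i by simp
  have Rc[measurable]: "(\<lambda>x. R x i) \<in> measurable P (M i)" by (rule measurable_compose[OF R c])
  have E[measurable]: "E \<in> sets P" unfolding E_def by measurable
  have pull: "prob G = prob {w \<in> space P. S w \<in> G}" if "G \<in> sets P" for G
    using measure_distr[OF S that] by (simp add: dS vimage_def Int_def conj_commute)
  have Sw: "AE w in P. S w \<in> space P" using measurable_space[OF S] by (intro AE_I2)
  have eq: "prob {x \<in> G. U t x \<in> E} = prob {w \<in> space P. T i t (w i) \<in> A \<and> w \<in> {w \<in> space P. S w \<in> G}}"
    if G[measurable]: "G \<in> sets P" for t G
  proof -
    have Gs: "G \<subseteq> space P" using G by (rule sets.sets_into_space)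
    have "AE x in P. R (U t x) = U t (R x)" using RS by (auto simp: conjugate_pair_def)
    then have "prob {x \<in> space P. R (U t x) i \<in> A \<and> x \<in> G} = prob {x \<in> space P. T i t (R x i) \<in> A \<and> x \<in> G}"
    proof (intro finite_measure_eq_AE)
      assume "AE x in P. R (U t x) = U t (R x)"
      then show "AE x in P. (x \<in> {x \<in> space P. R (U t x) i \<in> A \<and> x \<in> G})
          = (x \<in> {x \<in> space P. T i t (R x i) \<in> A \<and> x \<in> G})"
        by eventually_elim (simp add: product_flow_def i)
    qed measurable
    moreover have "{x \<in> G. U t x \<in> E} = {x \<in> space P. R (U t x) i \<in> A \<and> x \<in> G}"
      using Gs U_space by (auto simp: E_def)
    moreover have "prob {x \<in> space P. T i t (R x i) \<in> A \<and> x \<in> G}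
        = prob {w \<in> space P. S w \<in> {x \<in> space P. T i t (R x i) \<in> A \<and> x \<in> G}}"
      by (rule pull) measurable
    moreover have "\<dots> = prob {w \<in> space P. T i t (w i) \<in> A \<and> w \<in> {w \<in> space P. S w \<in> G}}"
    proof (intro finite_measure_eq_AE)
      show "AE w in P. (w \<in> {w \<in> space P. S w \<in> {x \<in> space P. T i t (R x i) \<in> A \<and> x \<in> G}})
          = (w \<in> {w \<in> space P. T i t (w i) \<in> A \<and> w \<in> {w \<in> space P. S w \<in> G}})"
        using RSx AE_space Sw by eventually_elim auto
    qed measurable
    ultimately show ?thesis by simp
  qed
  have lim: "joint G E = (1 - \<beta> i) * M.prob i A * prob G + \<beta> i * prob (E \<inter> G)"
    if C: "\<And>i. i \<in> I \<Longrightarrow> C i \<in> sets (M i)" and GC: "G = Pi\<^sub>E I C" for C G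
  proof -
    have G[measurable]: "G \<in> sets P" unfolding GC using C by (rule rectangle_sets)
    have l1: "(\<lambda>n. prob {x \<in> G. U (\<tau> n) x \<in> E}) \<longlonglongrightarrow> joint G E"
      unfolding GC by (rule flow_limit[OF E C])
    have l2: "(\<lambda>n. prob {x \<in> G. U (\<tau> n) x \<in> E}) \<longlonglongrightarrow>
      (1 - \<beta> i) * M.prob i A * prob {w \<in> space P. S w \<in> G}
      + \<beta> i * prob {w \<in> space P. w i \<in> A \<and> w \<in> {w \<in> space P. S w \<in> G}}"
      unfolding eq[OF G] by (rule component_limit[OF i A]) measurable
    have "prob {w \<in> space P. w i \<in> A \<and> w \<in> {w \<in> space P. S w \<in> G}} = prob {w \<in> space P. S w \<in> E \<inter> G}"
    proof (intro finite_measure_eq_AE)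
      show "AE w in P. (w \<in> {w \<in> space P. w i \<in> A \<and> w \<in> {w \<in> space P. S w \<in> G}})
          = (w \<in> {w \<in> space P. S w \<in> E \<inter> G})"
        using RSx AE_space Sw by eventually_elim (auto simp: E_def)
    qed measurable
    with LIMSEQ_unique[OF l1 l2] show ?thesis using pull[OF G] pull[of "E \<inter> G"] by simp
  qed
  have \<beta>01: "0 \<le> \<beta> i" "\<beta> i \<le> 1" using \<beta>_pos[OF i] \<beta>_less[OF i] by auto
  have bd: "0 \<le> (1 - \<beta> i) * M.prob i A + \<beta> i * indicator E x"
    "(1 - \<beta> i) * M.prob i A + \<beta> i * indicator E x \<le> 1" for x
  proof -
    have "(1 - \<beta> i) * M.prob i A \<le> (1 - \<beta> i) * 1" using \<beta>01 by (intro mult_left_mono) auto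
    then show "(1 - \<beta> i) * M.prob i A + \<beta> i * indicator E x \<le> 1" using \<beta>01 by (auto simp: indicator_def)
  qed (use \<beta>01 in auto)
  show ?thesis
  proof (rule AE_eq_of_rectangles[of _ _ 1])
    fix C assume C: "\<And>i. i \<in> I \<Longrightarrow> C i \<in> sets (M i)"
    define G where "G = Pi\<^sub>E I C"
    have G[measurable]: "G \<in> sets P" unfolding G_def using C by (rule rectangle_sets)
    have iG: "integrable P (\<lambda>x. indicator G x :: real)" "integrable P (\<lambda>x. indicator (E \<inter> G) x :: real)"
      by (rule integrable_bounded[of _ 1]; simp add: indicator_def)+
    have "(\<integral>x. indicator G x * ((1 - \<beta> i) * M.prob i A + \<beta> i * indicator E x) \<partial>P)
       = (\<integral>x. (1 - \<beta> i) * M.prob i A * indicator G x + \<beta> i * indicator (E \<inter> G) x \<partial>P)"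
      by (intro Bochner_Integration.integral_cong refl) (auto simp: indicator_def)
    also have "\<dots> = (1 - \<beta> i) * M.prob i A * prob G + \<beta> i * prob (E \<inter> G)"
      using iG by (simp add: Int_absorb2 sets.sets_into_space)
    also have "\<dots> = (\<integral>x. indicator G x * noise E x \<partial>P)"
      using lim[OF C G_def] joint_eq_integral[OF G E] by simp
    finally show "(\<integral>x. indicator (Pi\<^sub>E I C) x * noise E x \<partial>P)
       = (\<integral>x. indicator (Pi\<^sub>E I C) x * ((1 - \<beta> i) * M.prob i A + \<beta> i * indicator E x) \<partial>P)"
      by (simp add: G_def)
  qed (auto simp: noise_nonneg noise_le_1 bd)
qed

end

section \<open>Each output coordinate depends on a single input coordinate\<close>

context noise_product
begin

text \<open>If \<open>E\<close> depends on none of the coordinates in \<open>J\<close> separately, then resampling all of them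
at once almost surely does not affect membership in \<open>E\<close>.\<close>
lemma resample_set:
  assumes E[measurable]: "E \<in> sets P" and "finite J"
    and ind: "\<And>j. j \<in> J \<Longrightarrow> AE x in P. AE w in P. mix I (I - {j}) x w \<in> E \<longleftrightarrow> x \<in> E"
  shows "AE x in P. AE z in P. mix I (I - J) x z \<in> E \<longleftrightarrow> x \<in> E"
  using \<open>finite J\<close> ind
proof (induction J)
  case empty
  have "mix I I x z = x" if "x \<in> space P" for x z :: "'i \<Rightarrow> 'a"
    using that by (auto simp: mix_def space_PiM PiE_iff extensional_def fun_eq_iff)
  then show ?case by (auto intro!: AE_I2)
next
  case (insert j J)
  have "AE x in P. AE z' in P. AE z in P.
      mix I (I - {j}) (mix I (I - J) x z') z \<in> E \<longleftrightarrow> mix I (I - J) x z' \<in> E"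
    by (rule AE_mix) (use insert.prems in simp)
  moreover have "AE x in P. AE z' in P. mix I (I - J) x z' \<in> E \<longleftrightarrow> x \<in> E"
    using insert by simp
  moreover note AE_space
  ultimately show ?case
  proof eventually_elim
    case (elim x)
    note [measurable] = elim(3)
    from elim(1,2) have ae: "AE z' in P. AE z in P.
        mix I (I - insert j J) x (mix I (I - {j}) z' z) \<in> E \<longleftrightarrow> x \<in> E"
    proof eventually_elim
      case (elim z')
      have "mix I (I - {j}) (mix I (I - J) x z') z = mix I (I - insert j J) x (mix I (I - {j}) z' z)" for z
        using insert.hyps by (auto simp: mix_def)
      with elim show ?case by simp
    qed
    show ?case by (rule AE_mixD[OF _ ae]) measurable
  qed
qed

lemma AE_imp_ex: "AE x in P. Q x \<Longrightarrow> \<exists>x. Q x"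
  by (rule ccontr) simp

lemma component_independent:
  assumes "i \<in> I" "j \<in> I" "i \<noteq> j" and A: "A \<in> sets (M i)" and B: "B \<in> sets (M j)"
  shows "prob {x \<in> space P. x i \<in> A \<and> x j \<in> B} = M.prob i A * M.prob j B"
proof -
  have "emeasure P {x \<in> space P. \<forall>k\<in>{i, j}. x k \<in> (if k = i then A else B)}
      = (\<Prod>k\<in>{i, j}. emeasure (M k) (if k = i then A else B))"
    using assms by (intro emeasure_PiM_Collect) auto
  also have "\<dots> = emeasure (M i) A * emeasure (M j) B"
    using assms by simp
  also have "{x \<in> space P. \<forall>k\<in>{i, j}. x k \<in> (if k = i then A else B)}
      = {x \<in> space P. x i \<in> A \<and> x j \<in> B}" using assms by auto
  finally show ?thesis by (simp add: measure_def enn2real_mult)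
qed

lemma component_prob: "i \<in> I \<Longrightarrow> A \<in> sets (M i) \<Longrightarrow> prob {x \<in> space P. x i \<in> A} = M.prob i A"
  using emeasure_PiM_Collect_single by (simp add: measure_def)

lemma component_AE_unique:
  assumes ij: "i \<in> I" "j \<in> I" "i \<noteq> j" and A[measurable]: "A \<in> sets (M i)" and B[measurable]: "B \<in> sets (M j)"
    and ae: "AE x in P. x i \<in> A \<longleftrightarrow> x j \<in> B"
  shows "M.prob i A = 0 \<or> M.prob i A = 1"
proof -
  have [measurable]: "(\<lambda>x. x i) \<in> measurable P (M i)" "(\<lambda>x. x j) \<in> measurable P (M j)" using ij by auto
  have "prob {x \<in> space P. x i \<in> A} = prob {x \<in> space P. x j \<in> B}"
    using ae by (intro finite_measure_eq_AE) auto
  moreover have "prob {x \<in> space P. x i \<in> A} = prob {x \<in> space P. x i \<in> A \<and> x j \<in> B}"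
    using ae by (intro finite_measure_eq_AE) auto
  ultimately have eq: "M.prob i A = M.prob j B" "M.prob i A = M.prob i A * M.prob j B"
    unfolding component_independent[OF ij A B] component_prob[OF ij(1) A] component_prob[OF ij(2) B] .
  then have "M.prob i A * (1 - M.prob i A) = 0" by (simp add: algebra_simps)
  then show ?thesis by simp
qed

end

text \<open>The two properties of the factors, as measure spaces, that are used: countably many measurable sets separate
points, and some measurable set has measure strictly between \<open>0\<close> and \<open>1\<close>.\<close>
locale product_of_separated_flows = product_of_flows M I \<beta> T \<tau>
  for M :: "'i \<Rightarrow> 'a measure" and I :: "'i set" and \<beta> :: "'i \<Rightarrow> real"
    and T :: "'i \<Rightarrow> real \<Rightarrow> 'a \<Rightarrow> 'a" and \<tau> :: "nat \<Rightarrow> real" +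
  assumes separating: "i \<in> I \<Longrightarrow> \<exists>\<C>. countable \<C> \<and> \<C> \<subseteq> sets (M i) \<and>
      (\<forall>u\<in>space (M i). \<forall>v\<in>space (M i). (\<forall>A\<in>\<C>. u \<in> A \<longleftrightarrow> v \<in> A) \<longrightarrow> u = v)"
    and nontrivial: "i \<in> I \<Longrightarrow> \<exists>A\<in>sets (M i). 0 < M.prob i A \<and> M.prob i A < 1"
begin

text \<open>The coordinate \<open>i\<close> of \<open>R x\<close> is a function of \<open>x j\<close> alone. The equality of the noise parameters is part of
the notion because the induction on \<open>\<beta>\<close> relies on it.\<close>
definition factors :: "(('i \<Rightarrow> 'a) \<Rightarrow> 'i \<Rightarrow> 'a) \<Rightarrow> 'i \<Rightarrow> 'i \<Rightarrow> bool" where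
  "factors R i j \<longleftrightarrow> j \<in> I \<and> \<beta> j = \<beta> i \<and>
     (\<exists>Q\<in>measurable (M j) (M i). AE x in P. R x i = Q (x j))"

lemma component_measurable: "i \<in> I \<Longrightarrow> (\<lambda>x. x i) \<in> measurable P (M i)"
  by simp

text \<open>Let \<open>E = {x. R x i \<in> A}\<close>. If the claim fails, then by the dichotomy \<open>E\<close> depends on no coordinate in
\<open>J = {j. \<beta> j \<le> \<beta> i}\<close>. Resampling the coordinate
\<open>i\<close> of \<open>w\<close> leaves the coordinates of \<open>S w\<close> outside \<open>J\<close> unchanged by the induction hypothesis, so it does not
affect whether \<open>S w \<in> E\<close>, that is, whether \<open>w i \<in> A\<close>. Two independent samples of the coordinate \<open>i\<close> thus
lie in \<open>A\<close> together or not at all, which makes \<open>A\<close> trivial.\<close>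
lemma pullback_set_depends_on_one:
  assumes RS: "conjugate_pair R S" and i: "i \<in> I"
    and IH: "\<And>k. k \<in> I \<Longrightarrow> \<beta> i < \<beta> k \<Longrightarrow> \<exists>j. factors S k j"
    and A[measurable]: "A \<in> sets (M i)" and A01: "0 < M.prob i A" "M.prob i A < 1"
  shows "\<exists>j\<in>I. \<exists>B\<in>sets (M j). AE x in P. R x i \<in> A \<longleftrightarrow> x j \<in> B"
proof (rule ccontr)
  assume neg: "\<not> ?thesis"
  define E where "E = {x \<in> space P. R x i \<in> A}"
  have R[measurable]: "R \<in> measurable P P" and S[measurable]: "S \<in> measurable P P"
    and dS: "distr P P S = P" and RSx: "AE x in P. R (S x) = x"
    using RS by (auto simp: conjugate_pair_def)
  note c[measurable] = component_measurable[OF i]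
  have Rc[measurable]: "(\<lambda>x. R x i) \<in> measurable P (M i)" by (rule measurable_compose[OF R c])
  have E[measurable]: "E \<in> sets P" unfolding E_def by measurable
  define J where "J = {j \<in> I. \<beta> j \<le> \<beta> i}"
  have ind: "AE x in P. AE w in P. mix I (I - {j}) x w \<in> E \<longleftrightarrow> x \<in> E" if "j \<in> J" for j
  proof -
    have j: "j \<in> I" "\<beta> j \<le> \<beta> i" using that by (auto simp: J_def)
    have "\<not> (\<exists>A\<in>sets (M j). AE x in P. x \<in> E \<longleftrightarrow> x j \<in> A)"
    proof
      assume "\<exists>A\<in>sets (M j). AE x in P. x \<in> E \<longleftrightarrow> x j \<in> A"
      then obtain B where B: "B \<in> sets (M j)" "AE x in P. x \<in> E \<longleftrightarrow> x j \<in> B" by blast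
      have "AE x in P. R x i \<in> A \<longleftrightarrow> x j \<in> B"
        using B(2) AE_space by eventually_elim (simp add: E_def)
      with neg B(1) j(1) show False by blast
    qed
    with noise_dichotomy[OF j(1) E j(2) noise_pullback[OF RS i A, folded E_def]]
    show ?thesis by blast
  qed
  have "finite J" using finite_index by (simp add: J_def)
  then have res: "AE x in P. AE z in P. mix I (I - J) x z \<in> E \<longleftrightarrow> x \<in> E"
    by (rule resample_set[OF E _ ind])
  let ?m = "mix I (I - {i})"
  define Z where "Z w w' \<longleftrightarrow> (\<forall>k\<in>I - J. S w k = S w' k)" for w w' :: "'i \<Rightarrow> 'a"
  have Z: "AE w in P. AE v in P. Z w (?m w v)"
  proof -
    have "AE w in P. AE v in P. S w k = S (?m w v) k" if k: "k \<in> I - J" for k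
    proof -
      have ki: "k \<in> I" "\<beta> i < \<beta> k" using k by (auto simp: J_def)
      from IH[OF this] obtain j Q where j: "j \<in> I" "\<beta> j = \<beta> k" and Q: "AE x in P. S x k = Q (x j)"
        by (auto simp: factors_def)
      have "j \<noteq> i" using ki j by auto
      from AE_mix[OF Q, of "I - {i}"] Q show ?thesis
      proof eventually_elim
        case (elim w)
        from elim(1) show ?case
          by eventually_elim (use elim(2) j \<open>j \<noteq> i\<close> in \<open>simp add: mix_apply\<close>)
      qed
    qed
    then have "AE w in P. \<forall>k\<in>I - J. AE v in P. S w k = S (?m w v) k"
      using finite_index by (intro AE_finite_allI) auto
    then show ?thesis
    proof eventually_elim
      case (elim w)
      then show ?case unfolding Z_def using finite_index by (intro AE_finite_allI) auto
    qed
  qed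
  have resS: "AE w in P. AE z in P. mix I (I - J) (S w) z \<in> E \<longleftrightarrow> S w \<in> E"
    by (rule AE_transport[OF S dS res])
  have SE: "AE w in P. S w \<in> E \<longleftrightarrow> w i \<in> A"
  proof -
    have "AE w in P. S w \<in> space P" using measurable_space[OF S] by (intro AE_I2)
    with RSx show ?thesis by eventually_elim (simp add: E_def)
  qed
  have "AE w in P. AE v in P. w i \<in> A \<longleftrightarrow> v i \<in> A"
    using Z resS AE_mix[OF resS, of "I - {i}"] SE AE_mix[OF SE, of "I - {i}"]
  proof eventually_elim
    case (elim w)
    note w = elim
    from w(1,3,5) show ?case
    proof eventually_elim
      case (elim v)
      have "mix I (I - J) (S w) z = mix I (I - J) (S (?m w v)) z" for z
        using elim(1) by (intro mix_eqI) (auto simp: Z_def)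
      with w(2) elim(2) have "AE z in P. (S w \<in> E \<longleftrightarrow> S (?m w v) \<in> E)"
        by (elim AE_mp) (auto intro!: AE_I2)
      then have "S w \<in> E \<longleftrightarrow> S (?m w v) \<in> E" by simp
      with w(4) elim(3) show ?case using i by (simp add: mix_apply)
    qed
  qed
  then have ae: "AE w in P. (w i \<in> A \<longrightarrow> M.prob i A = 1)"
  proof eventually_elim
    case (elim w)
    show ?case
    proof
      assume "w i \<in> A"
      with elim have "AE v in P. v i \<in> A" by simp
      then have "prob {v \<in> space P. v i \<in> A} = 1" by (subst prob_Collect_eq_1) auto
      then show "M.prob i A = 1" using component_prob[OF i A] by simp
    qed
  qed
  then have "AE w in P. w i \<notin> A" using A01 by auto
  then have "prob {v \<in> space P. v i \<in> A} = 0" by (subst prob_Collect_eq_0) auto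
  with component_prob[OF i A] A01 show False by simp
qed

text \<open>The set \<open>{x. R x i \<in> A}\<close> satisfies the eigenvalue equation for \<open>\<beta> i\<close>, and the set \<open>{x. x j \<in> B}\<close>
that for \<open>\<beta> j\<close>. If a nontrivial set satisfies both, the two parameters agree.\<close>
lemma pullback_exponent:
  assumes RS: "conjugate_pair R S" and i: "i \<in> I" and j: "j \<in> I"
    and A[measurable]: "A \<in> sets (M i)" and A01: "0 < M.prob i A" "M.prob i A < 1"
    and B[measurable]: "B \<in> sets (M j)" and ae: "AE x in P. R x i \<in> A \<longleftrightarrow> x j \<in> B"
  shows "\<beta> j = \<beta> i" and "M.prob j B = M.prob i A"
proof -
  have R[measurable]: "R \<in> measurable P P" and dR: "distr P P R = P"
    using RS by (auto simp: conjugate_pair_def)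
  note c[measurable] = component_measurable[OF i] and d[measurable] = component_measurable[OF j]
  have Rc[measurable]: "(\<lambda>x. R x i) \<in> measurable P (M i)" by (rule measurable_compose[OF R c])
  define E where "E = {x \<in> space P. R x i \<in> A}"
  define F where "F = {x \<in> space P. x j \<in> B}"
  have [measurable]: "E \<in> sets P" "F \<in> sets P" unfolding E_def F_def by measurable
  have EF: "AE x in P. x \<in> E \<longleftrightarrow> x \<in> F" using ae by eventually_elim (auto simp: E_def F_def)
  have "prob E = M.prob i A"
  proof -
    have "prob E = measure (distr P P R) {x \<in> space P. x i \<in> A}"
      by (subst measure_distr) (auto simp: E_def intro!: arg_cong[where f=prob] dest: measurable_space[OF R])
    then show ?thesis by (simp add: dR component_prob i)
  qed
  moreover have "prob E = prob F" using EF by (intro finite_measure_eq_AE) auto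
  ultimately show pr: "M.prob j B = M.prob i A" using component_prob[OF j B] by (simp add: F_def)
  have "AE x in P. noise E x = noise F x" using EF by (intro noise_cong_AE) auto
  then have "AE x in P. (\<beta> j - \<beta> i) * (indicator E x - M.prob i A) = 0"
    using noise_pullback[OF RS i A, folded E_def] noise_pullback[OF conjugate_pair_id j B, folded F_def] EF
  proof eventually_elim
    case (elim x)
    then have "indicator E x = (indicator F x :: real)" by (simp add: indicator_def)
    with elim(1-3) show ?case by (simp add: pr algebra_simps)
  qed
  then obtain x where "(\<beta> j - \<beta> i) * (indicator E x - M.prob i A) = 0"
    using AE_imp_ex by blast
  with A01 show "\<beta> j = \<beta> i" by (cases "x \<in> E") auto
qed

lemma factors_step:
  assumes RS: "conjugate_pair R S" and i: "i \<in> I"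
    and IH: "\<And>k. k \<in> I \<Longrightarrow> \<beta> i < \<beta> k \<Longrightarrow> \<exists>j. factors S k j"
  shows "\<exists>j. factors R i j"
proof -
  have R[measurable]: "R \<in> measurable P P" and dR: "distr P P R = P"
    using RS by (auto simp: conjugate_pair_def)
  note c[measurable] = component_measurable[OF i]
  have Rc[measurable]: "(\<lambda>x. R x i) \<in> measurable P (M i)" by (rule measurable_compose[OF R c])
  have one: "\<exists>j\<in>I. \<exists>B\<in>sets (M j). AE x in P. R x i \<in> A \<longleftrightarrow> x j \<in> B"
    if "A \<in> sets (M i)" "0 < M.prob i A" "M.prob i A < 1" for A
    using pullback_set_depends_on_one[OF RS i _ that] IH by blast
  obtain A0 where A0: "A0 \<in> sets (M i)" "0 < M.prob i A0" "M.prob i A0 < 1"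
    using nontrivial[OF i] by blast
  obtain j B0 where j: "j \<in> I" and B0: "B0 \<in> sets (M j)" "AE x in P. R x i \<in> A0 \<longleftrightarrow> x j \<in> B0"
    using one[OF A0] by blast
  have \<beta>j: "\<beta> j = \<beta> i" by (rule pullback_exponent[OF RS i j A0 B0])
  have pB0: "M.prob j B0 = M.prob i A0" by (rule pullback_exponent[OF RS i j A0 B0])
  note d[measurable] = component_measurable[OF j]
  have all: "\<exists>B\<in>sets (M j). AE x in P. R x i \<in> A \<longleftrightarrow> x j \<in> B" if A: "A \<in> sets (M i)" for A
  proof -
    have pE: "prob {x \<in> space P. R x i \<in> A} = M.prob i A"
    proof -
      have "prob {x \<in> space P. R x i \<in> A} = measure (distr P P R) {x \<in> space P. x i \<in> A}"
        using A by (subst measure_distr) (auto intro!: arg_cong[where f=prob] dest: measurable_space[OF R])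
      then show ?thesis by (simp add: dR component_prob i A)
    qed
    note [measurable] = A
    have "M.prob i A = 0 \<or> M.prob i A = 1 \<or> (0 < M.prob i A \<and> M.prob i A < 1)"
      using M.prob_le_1[of i A] measure_nonneg[of "M i" A] by linarith
    then consider "M.prob i A = 0" | "M.prob i A = 1" | "0 < M.prob i A" "M.prob i A < 1" by blast
    then show ?thesis
    proof cases
      case 1
      with pE have "AE x in P. \<not> R x i \<in> A" by (simp add: prob_Collect_eq_0)
      then show ?thesis by (intro bexI[of _ "{}"]) auto
    next
      case 2
      with pE have "AE x in P. R x i \<in> A" by (simp add: prob_Collect_eq_1)
      then have "AE x in P. R x i \<in> A \<longleftrightarrow> x j \<in> space (M j)"
        using AE_space by eventually_elim (use j in \<open>auto simp: space_PiM\<close>)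
      then show ?thesis by blast
    next
      case 3
      then obtain k B where k: "k \<in> I" and B[measurable]: "B \<in> sets (M k)"
        and ae: "AE x in P. R x i \<in> A \<longleftrightarrow> x k \<in> B"
        using one[OF A] by blast
      have pB: "M.prob k B = M.prob i A" by (rule pullback_exponent[OF RS i k A 3 B ae])
      note [measurable] = component_measurable[OF k] B0(1) A0(1)
      show ?thesis
      proof (cases "k = j")
        case True
        with B ae show ?thesis by blast
      next
        case False
        \<comment> \<open>The preimages of \<open>A\<close> and \<open>A0\<close> are independent, so \<open>A \<inter> A0\<close> is again nontrivial and its
          preimage depends on one coordinate \<open>l\<close>. But \<open>l\<close> differs from \<open>j\<close> or from \<open>k\<close>, so the preimage is
          independent of a set of measure below \<open>1\<close> that contains it.\<close>
        have AA: "A \<inter> A0 \<in> sets (M i)" by simp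
        have AE2: "AE x in P. R x i \<in> A \<inter> A0 \<longleftrightarrow> x k \<in> B \<and> x j \<in> B0"
          using ae B0(2) by eventually_elim auto
        have "prob {x \<in> space P. R x i \<in> A \<inter> A0} = M.prob i (A \<inter> A0)"
        proof -
          have "prob {x \<in> space P. R x i \<in> A \<inter> A0} = measure (distr P P R) {x \<in> space P. x i \<in> A \<inter> A0}"
            by (subst measure_distr) (auto intro!: arg_cong[where f=prob] dest: measurable_space[OF R])
          then show ?thesis by (simp only: dR component_prob[OF i AA])
        qed
        moreover have "prob {x \<in> space P. R x i \<in> A \<inter> A0} = prob {x \<in> space P. x k \<in> B \<and> x j \<in> B0}"
          using AE2 by (intro finite_measure_eq_AE) auto
        moreover have "\<dots> = M.prob k B * M.prob j B0"
          by (rule component_independent[OF k j False B B0(1)])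
        ultimately have pAA: "M.prob i (A \<inter> A0) = M.prob i A * M.prob i A0"
          by (simp add: pB pB0)
        have "M.prob i A * M.prob i A0 < 1 * 1"
          using 3 A0 by (intro mult_strict_mono) auto
        then obtain l C where l: "l \<in> I" and C[measurable]: "C \<in> sets (M l)"
          and aeC: "AE x in P. R x i \<in> A \<inter> A0 \<longleftrightarrow> x l \<in> C"
          using one[OF AA] 3 A0 by (auto simp: pAA)
        have pC: "M.prob l C = M.prob i (A \<inter> A0)"
          using 3 A0 \<open>_ < 1 * 1\<close> by (intro pullback_exponent[OF RS i l AA _ _ C aeC]) (auto simp: pAA)
        note [measurable] = component_measurable[OF l]
        have pos: "0 < M.prob l C" using 3 A0 by (simp add: pC pAA)
        have contr: False
          if m: "m \<in> I" "l \<noteq> m" and D[measurable]: "D \<in> sets (M m)" and D1: "M.prob m D < 1"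
            and imp: "AE x in P. x l \<in> C \<longrightarrow> x m \<in> D" for m D
        proof -
          note [measurable] = component_measurable[OF m(1)]
          have "M.prob l C = prob {x \<in> space P. x l \<in> C}" using component_prob[OF l C] by simp
          also have "\<dots> = prob {x \<in> space P. x l \<in> C \<and> x m \<in> D}"
            using imp by (intro finite_measure_eq_AE) auto
          also have "\<dots> = M.prob l C * M.prob m D" by (rule component_independent[OF l m C D])
          finally show False using pos D1 by simp
        qed
        have False
        proof (cases "l = k")
          case True
          have "AE x in P. x l \<in> C \<longrightarrow> x j \<in> B0" using AE2 aeC by eventually_elim auto
          then show False using contr[OF j _ B0(1)] True False A0 by (simp add: pB0)
        next
          case False
          have "AE x in P. x l \<in> C \<longrightarrow> x k \<in> B" using AE2 aeC by eventually_elim auto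
          then show False using contr[OF k False B] 3 by (simp add: pB)
        qed
        then show ?thesis ..
      qed
    qed
  qed
  obtain \<C> where \<C>: "countable \<C>" "\<C> \<subseteq> sets (M i)"
    and sp: "\<forall>u\<in>space (M i). \<forall>v\<in>space (M i). (\<forall>A\<in>\<C>. u \<in> A \<longleftrightarrow> v \<in> A) \<longrightarrow> u = v"
    using separating[OF i] by (elim exE conjE) rule
  have sep: "u = v" if "u \<in> space (M i)" "v \<in> space (M i)" "\<forall>A\<in>\<C>. u \<in> A \<longleftrightarrow> v \<in> A" for u v
    using sp that by blast
  have "AE z in P. AE x in P. R x i \<in> A \<longleftrightarrow> R (mix I {j} x z) i \<in> A" if "A \<in> \<C>" for A
  proof -
    have "A \<in> sets (M i)" using that \<C> by blast
    then obtain B where B: "AE x in P. R x i \<in> A \<longleftrightarrow> x j \<in> B" using all by blast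
    from AE_mix'[OF B, of "{j}"] show ?thesis
    proof eventually_elim
      case (elim z)
      from elim B show ?case by eventually_elim (simp add: mix_apply j)
    qed
  qed
  then have "AE z in P. \<forall>A\<in>\<C>. AE x in P. R x i \<in> A \<longleftrightarrow> R (mix I {j} x z) i \<in> A"
    using \<C>(1) by (subst AE_ball_countable) auto
  then have "AE z in P. z \<in> space P \<and> (AE x in P. R x i = R (mix I {j} x z) i)"
    using AE_space
  proof eventually_elim
    case (elim z)
    then have "AE x in P. \<forall>A\<in>\<C>. R x i \<in> A \<longleftrightarrow> R (mix I {j} x z) i \<in> A"
      using \<C>(1) by (subst AE_ball_countable) auto
    then have "AE x in P. R x i = R (mix I {j} x z) i"
      using AE_space
    proof eventually_elim
      case (elim x)
      have "(\<lambda>x. mix I {j} x z) \<in> measurable P P" using \<open>z \<in> space P\<close> by measurable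
      from measurable_space[OF measurable_compose[OF this Rc] elim(2)] measurable_space[OF Rc elim(2)] elim(1)
      show ?case by (intro sep) auto
    qed
    with elim show ?case by simp
  qed
  then obtain z where z: "z \<in> space P" and zR: "AE x in P. R x i = R (mix I {j} x z) i"
    using AE_imp_ex by blast
  \<comment> \<open>Fixing the other coordinates at those of a generic point \<open>z\<close> yields the function of \<open>x j\<close>.\<close>
  let ?e = "\<lambda>u. \<lambda>k\<in>I. if k = j then u else z k"
  have "?e \<in> measurable (M j) P"
  proof (rule measurable_restrict)
    fix k assume "k \<in> I"
    with z show "(\<lambda>u. if k = j then u else z k) \<in> measurable (M j) (M k)"
      by (cases "k = j") (auto simp: space_PiM intro!: measurable_const dest: PiE_mem)
  qed
  then have Q: "(\<lambda>u. R (?e u) i) \<in> measurable (M j) (M i)" by (rule measurable_compose) (rule Rc)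
  have "mix I {j} x z = ?e (x j)" for x by (auto simp: mix_def)
  with zR have "AE x in P. R x i = R (?e (x j)) i" by simp
  then have "factors R i j"
    unfolding factors_def by (intro conjI j \<beta>j bexI[OF _ Q])
  then show ?thesis ..
qed

lemma factors_exists:
  assumes "conjugate_pair R S" and "i \<in> I"
  shows "\<exists>j. factors R i j"
  using assms
proof (induction "card {k \<in> I. \<beta> i < \<beta> k}" arbitrary: i R S rule: less_induct)
  case less
  show ?case
  proof (rule factors_step[OF less.prems])
    fix k assume k: "k \<in> I" "\<beta> i < \<beta> k"
    have "card {l \<in> I. \<beta> k < \<beta> l} < card {l \<in> I. \<beta> i < \<beta> l}"
      by (rule psubset_card_mono) (use finite_index k in auto)
    from less.hyps[OF this conjugate_pair_sym[OF less.prems(1)] k(1)] show "\<exists>j. factors S k j" .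
  qed
qed

end

section \<open>The permutation and the isomorphisms\<close>

context product_of_separated_flows
begin

text \<open>The separating sets stand in for the diagonal, whose measurability is not assumed.\<close>
lemma AE_component_eqD:
  assumes i: "i \<in> I" and j: "j \<in> I"
    and f[measurable]: "f \<in> measurable (M j) (M i)" and g[measurable]: "g \<in> measurable (M j) (M i)"
    and ae: "AE x in P. f (x j) = g (x j)"
  shows "AE u in M j. f u = g u"
proof -
  obtain \<C> where \<C>: "countable \<C>" "\<C> \<subseteq> sets (M i)"
    and sp: "\<forall>u\<in>space (M i). \<forall>v\<in>space (M i). (\<forall>A\<in>\<C>. u \<in> A \<longleftrightarrow> v \<in> A) \<longrightarrow> u = v"
    using separating[OF i] by (elim exE conjE) rule
  have sep: "u = v" if "u \<in> space (M i)" "v \<in> space (M i)" "\<forall>A\<in>\<C>. u \<in> A \<longleftrightarrow> v \<in> A" for u v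
    using sp that by blast
  have "AE u in M j. f u \<in> A \<longleftrightarrow> g u \<in> A" if "A \<in> \<C>" for A
  proof -
    have [measurable]: "A \<in> sets (M i)" using that \<C> by blast
    note [measurable] = component_measurable[OF j]
    have "AE x in P. f (x j) \<in> A \<longleftrightarrow> g (x j) \<in> A" using ae by eventually_elim simp
    then have "AE u in distr P (M j) (\<lambda>x. x j). f u \<in> A \<longleftrightarrow> g u \<in> A"
      by (subst AE_distr_iff) auto
    then show ?thesis unfolding PiM_component[OF j] .
  qed
  then have "AE u in M j. \<forall>A\<in>\<C>. f u \<in> A \<longleftrightarrow> g u \<in> A"
    using \<C>(1) by (subst AE_ball_countable) auto
  with AE_space show ?thesis
    by eventually_elim (intro sep, auto intro: measurable_space[OF f] measurable_space[OF g])
qed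

context
  fixes R S i j Q
  assumes RS: "conjugate_pair R S" and i: "i \<in> I" and j: "j \<in> I"
    and Q[measurable]: "Q \<in> measurable (M j) (M i)" and RQ: "AE x in P. R x i = Q (x j)"
begin

lemma factor_map_composition:
  assumes Q': "AE x in P. S x j = Q' (x k)"
  shows "AE x in P. x i = Q (Q' (x k))"
proof -
  have S: "S \<in> measurable P P" "distr P P S = P" and RSx: "AE x in P. R (S x) = x"
    using RS by (auto simp: conjugate_pair_def)
  from RSx AE_transport[OF S RQ] Q' show ?thesis by eventually_elim simp
qed

text \<open>Otherwise \<open>x i\<close> would be a function of \<open>x k\<close>, which is independent of it.\<close>
lemma factor_index_inverse:
  assumes k: "k \<in> I" and Q'[measurable]: "Q' \<in> measurable (M k) (M j)" and SQ: "AE x in P. S x j = Q' (x k)"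
  shows "k = i"
proof (rule ccontr)
  assume "k \<noteq> i"
  obtain A where A[measurable]: "A \<in> sets (M i)" "0 < M.prob i A" "M.prob i A < 1"
    using nontrivial[OF i] by blast
  define B where "B = {u \<in> space (M k). Q (Q' u) \<in> A}"
  have B: "B \<in> sets (M k)" unfolding B_def by measurable
  have "AE x in P. x i \<in> A \<longleftrightarrow> x k \<in> B"
    using factor_map_composition[OF SQ] AE_space
  proof eventually_elim
    case (elim x)
    then have "x k \<in> space (M k)" using k by (auto simp: space_PiM)
    with elim(1) show ?case by (simp add: B_def)
  qed
  from component_AE_unique[OF i k _ A(1) B this] \<open>k \<noteq> i\<close> A show False by simp
qed

lemma factor_map_preserves: "measure_preserving_map (M j) (M i) Q"
proof -
  have R[measurable]: "R \<in> measurable P P" and dR: "distr P P R = P"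
    using RS by (auto simp: conjugate_pair_def)
  note [measurable] = component_measurable[OF j] component_measurable[OF i]
  have Rc[measurable]: "(\<lambda>x. R x i) \<in> measurable P (M i)"
    by (rule measurable_compose[OF R component_measurable[OF i]])
  have "distr (M j) (M i) Q = distr (distr P (M j) (\<lambda>x. x j)) (M i) Q"
    by (simp add: PiM_component j)
  also have "\<dots> = distr P (M i) (\<lambda>x. Q (x j))"
    by (subst distr_distr) (auto simp: comp_def)
  also have "\<dots> = distr P (M i) (\<lambda>x. R x i)"
    using RQ by (intro distr_cong_AE) auto
  also have "\<dots> = distr (distr P P R) (M i) (\<lambda>x. x i)"
    by (subst distr_distr) (auto simp: comp_def)
  also have "\<dots> = M i" by (simp only: dR PiM_component[OF i])
  finally show ?thesis unfolding measure_preserving_map_def using Q by simp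
qed

lemma factor_map_equivariant: "AE u in M j. T i t (Q u) = Q (T j t u)"
proof (rule AE_component_eqD[OF i j])
  note [measurable] = T_measurable[OF i, of t] T_measurable[OF j, of t]
  show "(\<lambda>u. T i t (Q u)) \<in> measurable (M j) (M i)" "(\<lambda>u. Q (T j t u)) \<in> measurable (M j) (M i)"
    by measurable
  have "AE x in P. R (U t x) = U t (R x)" using RS by (auto simp: conjugate_pair_def)
  with RQ AE_transport[OF U_measurable U_distr RQ, of t] show "AE x in P. T i t (Q (x j)) = Q (T j t (x j))"
  proof eventually_elim
    case (elim x)
    have "R (U t x) i = T i t (R x i)" unfolding elim(3) by (simp add: product_flow_def i)
    with elim(1,2) show ?case by (simp add: product_flow_def j)
  qed
qed

end

lemma factor_isomorphism:
  assumes RS: "conjugate_pair R S" and i: "i \<in> I" and j: "j \<in> I"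
    and Q[measurable]: "Q \<in> measurable (M j) (M i)" and RQ: "AE x in P. R x i = Q (x j)"
    and Q'[measurable]: "Q' \<in> measurable (M i) (M j)" and SQ: "AE x in P. S x j = Q' (x i)"
  shows "flow_isomorphism (M j) (T j) (M i) (T i) Q"
proof -
  note SR = conjugate_pair_sym[OF RS]
  have "AE u in M i. Q (Q' u) = u"
    by (rule AE_component_eqD[OF i i])
       (use factor_map_composition[OF RS i j Q RQ SQ] in \<open>auto elim: eventually_mono\<close>)
  moreover have "AE u in M j. Q' (Q u) = u"
    by (rule AE_component_eqD[OF j j])
       (use factor_map_composition[OF SR j i Q' SQ RQ] in \<open>auto elim: eventually_mono\<close>)
  ultimately show ?thesis
    unfolding flow_isomorphism_def invertible_mp_map_def
    using factor_map_preserves[OF RS i j Q RQ] factor_map_preserves[OF SR j i Q' SQ]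
      factor_map_equivariant[OF RS i j Q RQ] by blast
qed

theorem conjugate_pair_structure:
  assumes RS: "conjugate_pair R S"
  shows "\<exists>\<sigma> Q. \<sigma> permutes I \<and>
    (\<forall>i\<in>I. isomorphic_flows (M i) (T i) (M (\<sigma> i)) (T (\<sigma> i))) \<and>
    (\<forall>i\<in>I. flow_isomorphism (M (\<sigma> i)) (T (\<sigma> i)) (M i) (T i) (Q i)) \<and>
    (AE x in P. R x = (\<lambda>i\<in>I. Q i (x (\<sigma> i))))"
proof -
  note SR = conjugate_pair_sym[OF RS]
  have "\<forall>i\<in>I. \<exists>j Q. j \<in> I \<and> Q \<in> measurable (M j) (M i) \<and> (AE x in P. R x i = Q (x j))"
    using factors_exists[OF RS] unfolding factors_def by blast
  from bchoice[OF this] obtain s where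
    "\<forall>i\<in>I. \<exists>Q. s i \<in> I \<and> Q \<in> measurable (M (s i)) (M i) \<and> (AE x in P. R x i = Q (x (s i)))" ..
  from bchoice[OF this] obtain Q where
    sQ: "\<forall>i\<in>I. s i \<in> I \<and> Q i \<in> measurable (M (s i)) (M i) \<and> (AE x in P. R x i = Q i (x (s i)))" ..
  then have s: "\<And>i. i \<in> I \<Longrightarrow> s i \<in> I"
    and Q: "\<And>i. i \<in> I \<Longrightarrow> Q i \<in> measurable (M (s i)) (M i)"
    and RQ: "\<And>i. i \<in> I \<Longrightarrow> AE x in P. R x i = Q i (x (s i))"
    by auto
  have "\<forall>i\<in>I. \<exists>j Q. j \<in> I \<and> Q \<in> measurable (M j) (M i) \<and> (AE x in P. S x i = Q (x j))"
    using factors_exists[OF SR] unfolding factors_def by blast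
  from bchoice[OF this] obtain r where
    "\<forall>i\<in>I. \<exists>Q. r i \<in> I \<and> Q \<in> measurable (M (r i)) (M i) \<and> (AE x in P. S x i = Q (x (r i)))" ..
  from bchoice[OF this] obtain Q' where
    sQ: "\<forall>i\<in>I. r i \<in> I \<and> Q' i \<in> measurable (M (r i)) (M i) \<and> (AE x in P. S x i = Q' i (x (r i)))" ..
  then have r: "\<And>i. i \<in> I \<Longrightarrow> r i \<in> I"
    and Q': "\<And>i. i \<in> I \<Longrightarrow> Q' i \<in> measurable (M (r i)) (M i)"
    and SQ: "\<And>i. i \<in> I \<Longrightarrow> AE x in P. S x i = Q' i (x (r i))"
    by auto
  have rs: "r (s i) = i" if i: "i \<in> I" for i
    by (rule factor_index_inverse[OF RS i s[OF i] Q[OF i] RQ[OF i] r[OF s[OF i]] Q'[OF s[OF i]] SQ[OF s[OF i]]])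
  have sr: "s (r i) = i" if i: "i \<in> I" for i
    by (rule factor_index_inverse[OF SR i r[OF i] Q'[OF i] SQ[OF i] s[OF r[OF i]] Q[OF r[OF i]] RQ[OF r[OF i]]])
  define \<sigma> where "\<sigma> i = (if i \<in> I then s i else i)" for i
  have "bij_betw s I I" by (rule bij_betw_byWitness[where f'=r]) (use rs sr r s in auto)
  then have "bij_betw \<sigma> I I" by (subst bij_betw_cong[where g=s]) (simp_all add: \<sigma>_def)
  then have "\<sigma> permutes I" by (rule bij_imp_permutes) (simp add: \<sigma>_def)
  moreover have "flow_isomorphism (M (\<sigma> i)) (T (\<sigma> i)) (M i) (T i) (Q i)"
    and "isomorphic_flows (M i) (T i) (M (\<sigma> i)) (T (\<sigma> i))" if i: "i \<in> I" for i
  proof -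
    have Q'i: "Q' (s i) \<in> measurable (M i) (M (s i))" "AE x in P. S x (s i) = Q' (s i) (x i)"
      using Q'[OF s[OF i]] SQ[OF s[OF i]] by (simp_all add: rs i)
    show "flow_isomorphism (M (\<sigma> i)) (T (\<sigma> i)) (M i) (T i) (Q i)"
      using factor_isomorphism[OF RS i s[OF i] Q[OF i] RQ[OF i] Q'i] by (simp add: \<sigma>_def i)
    show "isomorphic_flows (M i) (T i) (M (\<sigma> i)) (T (\<sigma> i))"
      unfolding isomorphic_flows_def
      using factor_isomorphism[OF SR s[OF i] i Q'i Q[OF i] RQ[OF i]] by (auto simp: \<sigma>_def i)
  qed
  moreover have "AE x in P. R x = (\<lambda>i\<in>I. Q i (x (\<sigma> i)))"
  proof -
    have R: "R \<in> measurable P P" using RS by (simp add: conjugate_pair_def)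
    have "AE x in P. \<forall>i\<in>I. R x i = Q i (x (s i))"
      using RQ finite_index by (intro AE_finite_allI) auto
    with AE_space show ?thesis
    proof eventually_elim
      case (elim x)
      have "R x \<in> extensional I" using measurable_space[OF R elim(1)] by (simp add: space_PiM PiE_iff)
      then show ?case
        by (rule extensionalityI[where A=I]) (use elim(2) in \<open>auto simp: \<sigma>_def\<close>)
    qed
  qed
  ultimately show ?thesis by blast
qed

lemma centralizer_conjugate_pair:
  assumes "R \<in> centralizer P U"
  shows "\<exists>S. conjugate_pair R S"
proof -
  from assms have R: "R \<in> measurable P P" "distr P P R = P" and com: "\<And>t. AE x in P. R (U t x) = U t (R x)"
    by (auto simp: centralizer_def invertible_mp_map_def measure_preserving_map_def)
  from assms obtain S where S: "S \<in> measurable P P" "distr P P S = P"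
    and SR: "AE x in P. S (R x) = x" and RS: "AE x in P. R (S x) = x"
    by (auto simp: centralizer_def invertible_mp_map_def measure_preserving_map_def)
  have "AE x in P. S (U t x) = U t (S x)" for t
    using RS AE_transport[OF S com[of t]] AE_transport[OF S AE_transport[OF U_measurable U_distr SR], of t]
  proof eventually_elim
    case (elim x)
    then have "S (U t x) = S (R (U t (S x)))" by simp
    with elim(3) show ?case by simp
  qed
  with R S SR RS com show ?thesis unfolding conjugate_pair_def by blast
qed

end

lemma standard_borel_separating:
  assumes "standard_borel N"
  shows "\<exists>\<C>. countable \<C> \<and> \<C> \<subseteq> sets N \<and>
    (\<forall>u\<in>space N. \<forall>v\<in>space N. (\<forall>A\<in>\<C>. u \<in> A \<longleftrightarrow> v \<in> A) \<longrightarrow> u = v)"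
proof -
  obtain X where X: "completely_metrizable_space X" "second_countable X" "topspace X = space N"
    and sets: "sets N = sigma_sets (space N) {U. openin X U}"
    using assms by (auto simp: standard_borel_def)
  obtain \<B> where \<B>: "countable \<B>" "\<And>V. V \<in> \<B> \<Longrightarrow> openin X V"
    and base: "\<And>U x. openin X U \<Longrightarrow> x \<in> U \<Longrightarrow> \<exists>V\<in>\<B>. x \<in> V \<and> V \<subseteq> U"
    using X(2) unfolding second_countable_def by metis
  have H: "Hausdorff_space X"
    using X(1) completely_metrizable_imp_metrizable_space metrizable_imp_Hausdorff_space by blast
  have "u = v" if uv: "u \<in> space N" "v \<in> space N" "\<forall>A\<in>\<B>. u \<in> A \<longleftrightarrow> v \<in> A" for u v
  proof (rule ccontr)
    assume "u \<noteq> v"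
    with H uv X(3) obtain U V where "openin X U" "openin X V" "u \<in> U" "v \<in> V" "disjnt U V"
      unfolding Hausdorff_space_def by metis
    with base[of U u] uv(3) show False by (auto simp: disjnt_iff)
  qed
  moreover have "\<B> \<subseteq> sets N" using \<B>(2) unfolding sets by auto
  ultimately show ?thesis using \<B>(1) by blast
qed

text \<open>If every set in a countable separating family is null or of full measure, then almost every point
lies in exactly those of these sets that have full measure, and there is only one such point.\<close>
lemma nontrivial_set:
  assumes "prob_space N" and \<C>: "countable \<C>" "\<C> \<subseteq> sets N"
    and sep: "\<And>u v. u \<in> space N \<Longrightarrow> v \<in> space N \<Longrightarrow> (\<forall>A\<in>\<C>. u \<in> A \<longleftrightarrow> v \<in> A) \<Longrightarrow> u = v"
    and nt: "\<not> (\<exists>x\<^sub>0\<in>space N. AE x in N. x = x\<^sub>0)"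
  shows "\<exists>A\<in>sets N. 0 < measure N A \<and> measure N A < 1"
proof (rule ccontr)
  interpret prob_space N by fact
  assume "\<not> ?thesis"
  then have 01: "prob A = 0 \<or> prob A = 1" if "A \<in> sets N" for A
    using that prob_le_1[of A] measure_nonneg[of N A] by (metis less_eq_real_def)
  have "AE x in N. x \<in> A \<longleftrightarrow> prob A = 1" if "A \<in> \<C>" for A
  proof -
    have A: "A \<in> sets N" using that \<C> by blast
    show ?thesis
    proof (cases "prob A = 1")
      case True
      with A have "AE x in N. x \<in> A" by (simp add: prob_eq_1)
      then show ?thesis by eventually_elim (simp add: True)
    next
      case False
      with 01[OF A] have "prob A = 0" by simp
      with A have "AE x in N. x \<notin> A" by (simp add: prob_eq_0)
      then show ?thesis by eventually_elim (simp add: False)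
    qed
  qed
  then have "AE x in N. \<forall>A\<in>\<C>. x \<in> A \<longleftrightarrow> prob A = 1"
    using \<C>(1) by (subst AE_ball_countable) auto
  with AE_space have ae: "AE x in N. x \<in> space N \<and> (\<forall>A\<in>\<C>. x \<in> A \<longleftrightarrow> prob A = 1)"
    by eventually_elim simp
  have "\<exists>x. x \<in> space N \<and> (\<forall>A\<in>\<C>. x \<in> A \<longleftrightarrow> prob A = 1)"
  proof (rule ccontr)
    assume "\<not> ?thesis"
    then have no: "\<not> (x \<in> space N \<and> (\<forall>A\<in>\<C>. x \<in> A \<longleftrightarrow> prob A = 1))" for x by blast
    from ae have "AE x in N. False" by eventually_elim (use no in blast)
    then show False by simp
  qed
  then obtain x0 where x0: "x0 \<in> space N" "\<forall>A\<in>\<C>. x0 \<in> A \<longleftrightarrow> prob A = 1" by blast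
  from ae have "AE x in N. x = x0"
    by eventually_elim (rule sep, use x0 in auto)
  with nt x0(1) show False by blast
qed

theorem corollary4:
  fixes d :: nat
    and M :: "nat \<Rightarrow> 'a measure"
    and T :: "nat \<Rightarrow> real \<Rightarrow> 'a \<Rightarrow> 'a"
    and \<alpha> :: "nat \<Rightarrow> real"
    and \<tau> :: "nat \<Rightarrow> real"
    and R :: "(nat \<Rightarrow> 'a) \<Rightarrow> nat \<Rightarrow> 'a"
  assumes "d \<ge> 1"
    and "\<And>i. i \<in> {1..d} \<Longrightarrow> flow (M i) (T i)"
    and "\<And>i. i \<in> {1..d} \<Longrightarrow> weakly_mixing (M i) (T i)"
    and "filterlim \<tau> at_top sequentially"
    and "\<And>i. i \<in> {1..d} \<Longrightarrow> 0 < \<alpha> i \<and> \<alpha> i < 1"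
    and "\<And>i. i \<in> {1..d} \<Longrightarrow> alpha_weakly_mixing_along (\<alpha> i) \<tau> (M i) (T i)"
    and "R \<in> centralizer (Pi\<^sub>M {1..d} M) (product_flow {1..d} T)"
  shows "\<exists>\<sigma> Q. \<sigma> permutes {1..d} \<and>
           (\<forall>i\<in>{1..d}. isomorphic_flows (M i) (T i) (M (\<sigma> i)) (T (\<sigma> i))) \<and>
           (\<forall>i\<in>{1..d}. flow_isomorphism (M (\<sigma> i)) (T (\<sigma> i)) (M i) (T i) (Q i)) \<and>
           (AE x in Pi\<^sub>M {1..d} M. R x = (\<lambda>i\<in>{1..d}. Q i (x (\<sigma> i))))"
proof -
  \<comment> \<open>All indices outside \<open>{1..d}\<close> receive the space of index \<open>1\<close>, so that the whole family consists of probability spaces.\<close>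
  define M' where "M' i = (if i \<in> {1..d} then M i else M 1)" for i
  have flow': "flow (M i) (T i)" if "i \<in> {1..d}" for i using that assms(2) by simp
  have M': "M' i = M i" if "i \<in> {1..d}" for i using that by (simp add: M'_def)
  have "prob_space (M i)" if "i \<in> {1..d}" for i using flow'[OF that] by (simp add: flow_def)
  then have prob: "prob_space (M' i)" for i using \<open>d \<ge> 1\<close> by (simp add: M'_def)
  have PM: "Pi\<^sub>M {1..d} M' = Pi\<^sub>M {1..d} M" by (rule PiM_cong) (simp_all add: M')
  interpret product_of_separated_flows M' "{1..d}" "\<lambda>i. 1 - \<alpha> i" T \<tau>
  proof unfold_locales
    fix i
    interpret prob_space "M' i" by (rule prob)
    show "emeasure (M' i) (space (M' i)) = 1" by (rule emeasure_space_1)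
    show "\<exists>A. countable A \<and> A \<subseteq> sets (M' i) \<and> \<Union> A = space (M' i) \<and> (\<forall>a\<in>A. emeasure (M' i) a \<noteq> \<infinity>)"
      by (rule sigma_finite_countable)
  next
    fix i t assume i: "i \<in> {1..d}"
    show "measure_preserving_map (M' i) (M' i) (T i t)"
      using flow'[OF i] by (simp add: M'[OF i] flow_def)
    show "alpha_weakly_mixing_along (1 - (1 - \<alpha> i)) \<tau> (M' i) (T i)"
      using assms(6)[OF i] by (simp add: M'[OF i])
    have "standard_borel (M i)" using flow'[OF i] by (simp add: flow_def)
    from standard_borel_separating[OF this]
    show sep: "\<exists>\<C>. countable \<C> \<and> \<C> \<subseteq> sets (M' i) \<and>
        (\<forall>u\<in>space (M' i). \<forall>v\<in>space (M' i). (\<forall>A\<in>\<C>. u \<in> A \<longleftrightarrow> v \<in> A) \<longrightarrow> u = v)"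
      by (simp add: M'[OF i])
    then obtain \<C> where \<C>: "countable \<C>" "\<C> \<subseteq> sets (M' i)"
      "\<And>u v. u \<in> space (M' i) \<Longrightarrow> v \<in> space (M' i) \<Longrightarrow> (\<forall>A\<in>\<C>. u \<in> A \<longleftrightarrow> v \<in> A) \<Longrightarrow> u = v"
      by blast
    have "\<not> (\<exists>x\<^sub>0\<in>space (M' i). AE x in M' i. x = x\<^sub>0)"
      using flow'[OF i] unfolding M'[OF i] flow_def by blast
    from nontrivial_set[OF prob \<C> this]
    show "\<exists>A\<in>sets (M' i). 0 < measure (M' i) A \<and> measure (M' i) A < 1" .
    show "0 < 1 - \<alpha> i" "1 - \<alpha> i < 1" using assms(5)[OF i] by auto
  qed (simp_all add: prob_space.emeasure_space_1[OF prob])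
  have "R \<in> centralizer (Pi\<^sub>M {1..d} M') (product_flow {1..d} T)"
    using assms(7) by (simp only: PM)
  then obtain S where "conjugate_pair R S" using centralizer_conjugate_pair by blast
  from conjugate_pair_structure[OF this] obtain \<sigma> Q where \<sigma>: "\<sigma> permutes {1..d}"
    and iso: "\<And>i. i \<in> {1..d} \<Longrightarrow> isomorphic_flows (M' i) (T i) (M' (\<sigma> i)) (T (\<sigma> i))"
    and Q: "\<And>i. i \<in> {1..d} \<Longrightarrow> flow_isomorphism (M' (\<sigma> i)) (T (\<sigma> i)) (M' i) (T i) (Q i)"
    and ae: "AE x in Pi\<^sub>M {1..d} M'. R x = (\<lambda>i\<in>{1..d}. Q i (x (\<sigma> i)))"
    by blast
  have \<sigma>M: "M' (\<sigma> i) = M (\<sigma> i)" if "i \<in> {1..d}" for i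
    using permutes_in_image[OF \<sigma>, of i] that by (intro M') blast
  show ?thesis
    using \<sigma> iso Q ae[unfolded PM] by (intro exI[of _ \<sigma>] exI[of _ Q]) (simp add: \<sigma>M M')
qed

end
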